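(* Let $G$ be a connected uniform graph and let $m\ge0$ be an integer. If every minimal vertex separator in $G$ has diameter at most $m$, then $G$ satisfies the Bottleneck Property (BP) (i.e., $G$ is quasi-isometric to a tree). Moreover, (BP) holds with constant $\Delta=m+2$.
   Context: Every edge of the connected graph $G$ has length $1$, interior points of edges are points of $G$, and $d$ is the induced shortest-path (length) metric on $G$, making $G$ a geodesic metric space; $V(G)$ is the vertex set. Diameters are taken with respect to $d$. $G$ is uniform if there is a constant $\mu$ such that every vertex has at most $\mu$ neighbors. A set $S\subset V(G)$ is an $ab$-separator (for vertices $a,b$) if $a$ and $b$ lie in different connected components of $G\setminus S$. It is a minimal $ab$-separator if no proper subset of $S$ separates $a$ and $b$. $S$ is a minimal vertex separator if it is a minimal $ab$-separator for some pair of vertices $a,b$. A geodesic metric space $(X,d)$ satisfies the Bottleneck Property (BP) with constant $\Delta>0$ if, given any two distinct points $x,y\in X$ and any midpoint $z$, i.e. $d(x,z)=d(z,y)=\frac12 d(x,y)$, every $xy$-path (path in $X$ joining $x$ to $y$) intersects $N_\Delta(z)=\{w : d(z,w)\le\Delta\}$. It satisfies (BP) if it does so for some $\Delta>0$. (A geodesic metric space satisfies (BP) if and only if it is quasi-isometric to a tree, by a theorem of Manning.) A map $f:(X,d_X)\to(Y,d_Y)$ between metric spaces is a quasi-isometry if there are constants $\lambda\ge1$, $C>0$, $D>0$ such that $\frac1\lambda d_X(x,x')-C\le d_Y(f(x),f(x'))\le\lambda d_X(x,x')+C$ for all $x,x'\in X$ and $d_Y(y,f(X))\le D$ for all $y\in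 Y$; then $X$ and $Y$ are quasi-isometric. *)

theory Defs
  imports "HOL-Analysis.Analysis"
begin

section \<open>Graphs\<close>

text \<open>
  Graphs are simple and undirected, possibly infinite: a vertex set \<open>V\<close> and a set \<open>E\<close> of
  two-element subsets of \<open>V\<close>.
\<close>

definition simple_graph :: "'v set \<Rightarrow> 'v set set \<Rightarrow> bool" where
  "simple_graph V E \<longleftrightarrow> (\<forall>e\<in>E. \<exists>u\<in>V. \<exists>v\<in>V. u \<noteq> v \<and> e = {u, v})"

text \<open>
  The vertex set of the connected component of \<open>a\<close> in the subgraph induced on \<open>W\<close>
  (meaningful for \<open>a \<in> W\<close>).
\<close>

definition component :: "'v set set \<Rightarrow> 'v set \<Rightarrow> 'v \<Rightarrow> 'v set" where
  "component E W a = {b \<in> W. (\<lambda>u v. u \<in> W \<and> v \<in> W \<and> {u, v} \<in> E)\<^sup>*\<^sup>* a b}"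

definition connected_graph :: "'v set \<Rightarrow> 'v set set \<Rightarrow> bool" where
  "connected_graph V E \<longleftrightarrow>
     simple_graph V E \<and> V \<noteq> {} \<and> (\<forall>a\<in>V. \<forall>b\<in>V. b \<in> component E V a)"

definition neighbors :: "'v set set \<Rightarrow> 'v \<Rightarrow> 'v set" where
  "neighbors E v = {u. {u, v} \<in> E}"

definition uniform_graph :: "'v set \<Rightarrow> 'v set set \<Rightarrow> bool" where
  "uniform_graph V E \<longleftrightarrow>
     (\<exists>\<mu>::nat. \<forall>v\<in>V. finite (neighbors E v) \<and> card (neighbors E v) \<le> \<mu>)"

definition is_cycle :: "'v set set \<Rightarrow> 'v list \<Rightarrow> bool" where
  "is_cycle E vs \<longleftrightarrow> length vs \<ge> 3 \<and> distinct vs \<and>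
     successively (\<lambda>u v. {u, v} \<in> E) vs \<and> {last vs, hd vs} \<in> E"

definition tree_graph :: "'v set \<Rightarrow> 'v set set \<Rightarrow> bool" where
  "tree_graph V E \<longleftrightarrow> connected_graph V E \<and> (\<nexists>vs. is_cycle E vs)"


section \<open>Vertex separators\<close>

definition separates :: "'v set \<Rightarrow> 'v set set \<Rightarrow> 'v set \<Rightarrow> 'v \<Rightarrow> 'v \<Rightarrow> bool" where
  "separates V E S a b \<longleftrightarrow> S \<subseteq> V \<and> a \<in> V - S \<and> b \<in> V - S \<and>
     component E (V - S) a \<noteq> component E (V - S) b"

definition minimal_ab_separator :: "'v set \<Rightarrow> 'v set set \<Rightarrow> 'v set \<Rightarrow> 'v \<Rightarrow> 'v \<Rightarrow> bool" where
  "minimal_ab_separator V E S a b \<longleftrightarrow>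
     separates V E S a b \<and> (\<forall>S'. S' \<subset> S \<longrightarrow> \<not> separates V E S' a b)"

definition minimal_vertex_separator :: "'v set \<Rightarrow> 'v set set \<Rightarrow> 'v set \<Rightarrow> bool" where
  "minimal_vertex_separator V E S \<longleftrightarrow> (\<exists>a\<in>V. \<exists>b\<in>V. minimal_ab_separator V E S a b)"


section \<open>The metric graph\<close>

text \<open>
  A point of the geometric realization is given by its barycentric coordinates: the point at
  distance \<open>t\<close> from \<open>u\<close> on the edge \<open>{u, v}\<close> is the function with value \<open>1 - t\<close> at \<open>u\<close>, \<open>t\<close> at \<open>v\<close>
  and \<open>0\<close> elsewhere. The closed cell of \<open>{v}\<close> consists of the single point \<open>vertex_point v\<close>.
\<close>

definition closed_cell :: "'v set \<Rightarrow> ('v \<Rightarrow> real) set" where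
  "closed_cell e = {p. (\<forall>w. 0 \<le> p w) \<and> (\<forall>w. w \<notin> e \<longrightarrow> p w = 0) \<and> (\<Sum>w\<in>e. p w) = 1}"

definition vertex_point :: "'v \<Rightarrow> ('v \<Rightarrow> real)" where
  "vertex_point v = indicator {v}"

definition realization :: "'v set \<Rightarrow> 'v set set \<Rightarrow> ('v \<Rightarrow> real) set" where
  "realization V E = (\<Union>v\<in>V. closed_cell {v}) \<union> (\<Union>e\<in>E. closed_cell e)"

text \<open>
  The length of the segment between two points of a common closed edge: for the points of
  \<open>{u, v}\<close> at distances \<open>s\<close> and \<open>t\<close> from \<open>u\<close> it is \<open>(\<bar>s - t\<bar> + \<bar>s - t\<bar>) / 2 = \<bar>s - t\<bar>\<close>,
  so every edge has length \<open>1\<close>.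
\<close>

definition seg_length :: "('v \<Rightarrow> real) \<Rightarrow> ('v \<Rightarrow> real) \<Rightarrow> real" where
  "seg_length p q = (\<Sum>w | p w \<noteq> 0 \<or> q w \<noteq> 0. \<bar>p w - q w\<bar>) / 2"

text \<open>Piecewise linear paths, given by their lists of break points.\<close>

definition pl_paths :: "'v set set \<Rightarrow> ('v \<Rightarrow> real) \<Rightarrow> ('v \<Rightarrow> real) \<Rightarrow> ('v \<Rightarrow> real) list set" where
  "pl_paths E p q = {xs. xs \<noteq> [] \<and> hd xs = p \<and> last xs = q \<and>
     successively (\<lambda>x y. \<exists>e\<in>E. x \<in> closed_cell e \<and> y \<in> closed_cell e) xs}"

definition pl_length :: "('v \<Rightarrow> real) list \<Rightarrow> real" where
  "pl_length xs = (\<Sum>i<length xs - 1. seg_length (xs ! i) (xs ! Suc i))"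

text \<open>
  The length metric. The value \<open>0\<close> in the absence of paths is a dummy: in a connected graph it only
  concerns functions that are not points of the realization, and it is there because the
  locale \<open>Metric_space\<close> wants nonnegativity and symmetry on the whole type.
\<close>

definition path_dist :: "'v set set \<Rightarrow> ('v \<Rightarrow> real) \<Rightarrow> ('v \<Rightarrow> real) \<Rightarrow> real" where
  "path_dist E p q =
     (if pl_paths E p q = {} then 0 else (INF xs\<in>pl_paths E p q. pl_length xs))"

definition metric_graph :: "'v set \<Rightarrow> 'v set set \<Rightarrow> ('v \<Rightarrow> real) metric" where
  "metric_graph V E = metric (realization V E, path_dist E)"


section \<open>Metric notions\<close>

text \<open>Extended-valued, so that unbounded sets have diameter \<open>\<infinity>\<close>.\<close>

definition mdiameter :: "'a metric \<Rightarrow> 'a set \<Rightarrow> ennreal" where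
  "mdiameter X S = (SUP x\<in>S. SUP y\<in>S. ennreal (mdist X x y))"

definition bottleneck_with :: "'a metric \<Rightarrow> real \<Rightarrow> bool" where
  "bottleneck_with X \<Delta> \<longleftrightarrow> \<Delta> > 0 \<and>
     (\<forall>x\<in>mspace X. \<forall>y\<in>mspace X. \<forall>z\<in>mspace X.
        x \<noteq> y \<and> mdist X x z = mdist X x y / 2 \<and> mdist X z y = mdist X x y / 2 \<longrightarrow>
        (\<forall>g. pathin (mtopology_of X) g \<and> g 0 = x \<and> g 1 = y \<longrightarrow>
           g ` {0..1} \<inter> {w \<in> mspace X. mdist X z w \<le> \<Delta>} \<noteq> {}))"

definition bottleneck_property :: "'a metric \<Rightarrow> bool" where
  "bottleneck_property X \<longleftrightarrow> (\<exists>\<Delta>. bottleneck_with X \<Delta>)"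

text \<open>For nonempty spaces; the infimum is the distance from \<open>y\<close> to the image of \<open>f\<close>.\<close>

definition quasi_isometry :: "'a metric \<Rightarrow> 'b metric \<Rightarrow> ('a \<Rightarrow> 'b) \<Rightarrow> bool" where
  "quasi_isometry X Y f \<longleftrightarrow> f \<in> mspace X \<rightarrow> mspace Y \<and>
     (\<exists>L C D. L \<ge> 1 \<and> C > 0 \<and> D > 0 \<and>
        (\<forall>x\<in>mspace X. \<forall>x'\<in>mspace X.
           1 / L * mdist X x x' - C \<le> mdist Y (f x) (f x') \<and>
           mdist Y (f x) (f x') \<le> L * mdist X x x' + C) \<and>
        (\<forall>y\<in>mspace Y. (INF x\<in>mspace X. mdist Y y (f x)) \<le> D))"

definition quasi_isometric :: "'a metric \<Rightarrow> 'b metric \<Rightarrow> bool" where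
  "quasi_isometric X Y \<longleftrightarrow> (\<exists>f. quasi_isometry X Y f)"


section \<open>The metric graph of a connected graph is a metric space\<close>

lemma closed_cell_support:
  assumes "p \<in> closed_cell e"
  shows "finite {w. p w \<noteq> 0}" "\<exists>w\<in>e. p w > 0"
proof -
  have "finite e" using assms by (auto simp: closed_cell_def intro: ccontr)
  then show "finite {w. p w \<noteq> 0}"
    using assms by (auto simp: closed_cell_def intro: finite_subset[of _ e])
  show "\<exists>w\<in>e. p w > 0"
  proof (rule ccontr)
    assume "\<not> ?thesis"
    then have "\<forall>w\<in>e. p w = 0" using assms by (force simp: closed_cell_def not_less intro: antisym)
    then show False using assms by (simp add: closed_cell_def)
  qed
qed

lemma closed_cell_singleton: "closed_cell {v} = {vertex_point v}"
  by (auto simp: closed_cell_def vertex_point_def indicator_def fun_eq_iff)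

lemma seg_length_superset:
  assumes "finite F" "{w. p w \<noteq> 0 \<or> q w \<noteq> 0} \<subseteq> F"
  shows "seg_length p q = (\<Sum>w\<in>F. \<bar>p w - q w\<bar>) / 2"
  unfolding seg_length_def using assms by (auto intro!: sum.mono_neutral_left)

lemma seg_length_nonneg: "0 \<le> seg_length p q"
  unfolding seg_length_def by (simp add: sum_nonneg)

lemma seg_length_commute: "seg_length p q = seg_length q p"
  unfolding seg_length_def by (simp add: abs_minus_commute disj_commute)

lemma seg_length_triangle:
  assumes "finite {w. p w \<noteq> 0}" "finite {w. q w \<noteq> 0}" "finite {w. r w \<noteq> 0}"
  shows "seg_length p r \<le> seg_length p q + seg_length q r"
proof -
  let ?F = "{w. p w \<noteq> 0} \<union> {w. q w \<noteq> 0} \<union> {w. r w \<noteq> 0}"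
  have F: "finite ?F" using assms by simp
  have "(\<Sum>w\<in>?F. \<bar>p w - r w\<bar>) \<le> (\<Sum>w\<in>?F. \<bar>p w - q w\<bar> + \<bar>q w - r w\<bar>)"
    by (rule sum_mono) simp
  then show ?thesis
    using F by (subst (1 2 3) seg_length_superset[of ?F]) (auto simp: sum.distrib)
qed

lemma seg_length_pos:
  assumes "finite {w. p w \<noteq> 0}" "finite {w. q w \<noteq> 0}" "p \<noteq> q"
  shows "seg_length p q > 0"
proof -
  let ?F = "{w. p w \<noteq> 0 \<or> q w \<noteq> 0}"
  obtain w where w: "p w \<noteq> q w" using assms(3) by auto
  have "finite ?F" unfolding Collect_disj_eq using assms(1,2) by (rule finite_UnI)
  then have "(\<Sum>w\<in>?F. \<bar>p w - q w\<bar>) > 0"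
    using w by (intro sum_pos2[of _ w]) auto
  then show ?thesis unfolding seg_length_def by simp
qed

lemma pl_length_nonneg: "0 \<le> pl_length xs"
  unfolding pl_length_def by (simp add: sum_nonneg seg_length_nonneg)

lemma pl_length_Nil [simp]: "pl_length [] = 0"
  and pl_length_singleton [simp]: "pl_length [x] = 0"
  and pl_length_Cons [simp]: "pl_length (x # y # ys) = seg_length x y + pl_length (y # ys)"
  unfolding pl_length_def by (simp_all add: sum.lessThan_Suc_shift del: sum.lessThan_Suc)

lemma pl_length_append:
  "xs \<noteq> [] \<Longrightarrow> ys \<noteq> [] \<Longrightarrow>
     pl_length (xs @ ys) = pl_length xs + seg_length (last xs) (hd ys) + pl_length ys"
proof (induction xs)
  case (Cons x xs)
  then show ?case by (cases xs; cases ys) auto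
qed simp

lemma pl_length_rev: "pl_length (rev xs) = pl_length xs"
proof (induction xs)
  case (Cons x xs)
  then show ?case
    by (cases xs) (auto simp: pl_length_append[of "rev _ @ [_]" "[x]", simplified] seg_length_commute)
qed simp

lemma seg_length_self [simp]: "seg_length p p = 0"
  by (simp add: seg_length_def)

lemma pl_paths_rev: "xs \<in> pl_paths E p q \<Longrightarrow> rev xs \<in> pl_paths E q p"
  unfolding pl_paths_def by (auto simp: hd_rev last_rev elim: successively_mono)

lemma pl_paths_trans:
  assumes xs: "xs \<in> pl_paths E p q" and ys: "ys \<in> pl_paths E q r"
  shows "\<exists>zs\<in>pl_paths E p r. pl_length zs = pl_length xs + pl_length ys"
proof (cases "tl ys")
  case Nil
  then have "ys = [q]" "r = q" using ys by (cases ys; auto simp: pl_paths_def)+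
  then show ?thesis using xs by (intro bexI[of _ xs]) auto
next
  case (Cons z zs)
  then have ys': "ys = q # z # zs" using ys by (cases ys) (auto simp: pl_paths_def)
  have "xs @ z # zs \<in> pl_paths E p r"
    using xs ys unfolding ys' pl_paths_def by (auto simp: successively_append_iff)
  moreover have "pl_length (xs @ z # zs) = pl_length xs + pl_length ys"
    using xs unfolding ys' by (subst pl_length_append) (auto simp: pl_paths_def)
  ultimately show ?thesis by blast
qed

lemma pl_length_ge:
  assumes "xs \<in> pl_paths E p q" "finite {w. p w \<noteq> 0}"
  shows "seg_length p q \<le> pl_length xs"
  using assms
proof (induction xs arbitrary: p)
  case Nil
  then show ?case by (simp add: pl_paths_def)
next
  case (Cons x xs)
  show ?case
  proof (cases xs)
    case Nil
    then show ?thesis using Cons.prems by (auto simp: pl_paths_def)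
  next
    case (Cons y ys)
    have x: "x = p" using Cons.prems by (simp add: pl_paths_def)
    have y: "finite {w. y w \<noteq> 0}" and p: "xs \<in> pl_paths E y q"
      using Cons.prems \<open>xs = y # ys\<close> closed_cell_support(1) by (auto simp: pl_paths_def)
    have fin_last: "finite {w. last zs w \<noteq> 0}"
      if "zs \<in> pl_paths E r q" "finite {w. r w \<noteq> 0}" for r zs
      using that
    proof (induction zs arbitrary: r)
      case (Cons z zs)
      then show ?case
        by (cases zs) (auto simp: pl_paths_def dest: closed_cell_support(1))
    qed (simp add: pl_paths_def)
    have "finite {w. q w \<noteq> 0}" using fin_last[OF p y] p by (simp add: pl_paths_def)
    then have "seg_length p q \<le> seg_length p y + seg_length y q"
      using Cons.prems(2) y by (intro seg_length_triangle)
    then show ?thesis using Cons.IH[OF p y] x \<open>xs = y # ys\<close> by simp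
  qed
qed

lemma path_dist_nonneg: "0 \<le> path_dist E p q"
  unfolding path_dist_def by (auto intro: cINF_greatest pl_length_nonneg)

lemma path_dist_le: "xs \<in> pl_paths E p q \<Longrightarrow> path_dist E p q \<le> pl_length xs"
  unfolding path_dist_def
  by (auto intro!: cINF_lower bdd_belowI[of _ 0] simp: pl_length_nonneg)

lemma path_dist_commute_le: "path_dist E p q \<le> path_dist E q p"
proof (cases "pl_paths E q p = {}")
  case True
  then have "pl_paths E p q = {}" using pl_paths_rev by blast
  then show ?thesis using True by (simp add: path_dist_def)
next
  case False
  have "path_dist E p q \<le> pl_length xs" if "xs \<in> pl_paths E q p" for xs
    using path_dist_le[OF pl_paths_rev[OF that]] by (simp add: pl_length_rev)
  then show ?thesis using False unfolding path_dist_def[of E q p]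
    by (auto intro: cINF_greatest)
qed

lemma realization_cases:
  assumes "connected_graph V E" "p \<in> realization V E"
  obtains v where "v \<in> V" "pl_paths E p (vertex_point v) \<noteq> {}"
proof -
  from assms(2) consider v where "v \<in> V" "p = vertex_point v" | e where "e \<in> E" "p \<in> closed_cell e"
    by (auto simp: realization_def closed_cell_singleton)
  then show thesis
  proof cases
    case 1
    then have "[p] \<in> pl_paths E p (vertex_point v)" by (simp add: pl_paths_def)
    then show thesis using that 1 by blast
  next
    case 2
    obtain u v where e: "u \<in> V" "u \<noteq> v" "e = {u, v}"
      using assms(1) 2 unfolding connected_graph_def simple_graph_def by blast
    have "vertex_point u \<in> closed_cell e"
      using e by (auto simp: closed_cell_def vertex_point_def indicator_def)
    then have "[p, vertex_point u] \<in> pl_paths E p (vertex_point u)"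
      using 2 by (auto simp: pl_paths_def)
    then show thesis using that e by blast
  qed
qed

lemma pl_paths_vertices:
  assumes "connected_graph V E" "u \<in> V" "v \<in> V"
  shows "pl_paths E (vertex_point u) (vertex_point v) \<noteq> {}"
proof -
  have "(\<lambda>u v. u \<in> V \<and> v \<in> V \<and> {u, v} \<in> E)\<^sup>*\<^sup>* u v"
    using assms by (auto simp: connected_graph_def component_def)
  then show ?thesis
  proof induction
    case base
    have "[vertex_point u] \<in> pl_paths E (vertex_point u) (vertex_point u)"
      by (simp add: pl_paths_def)
    then show ?case by blast
  next
    case (step y z)
    have "y \<noteq> z"
      using step.hyps(2) assms(1) unfolding connected_graph_def simple_graph_def
      by (metis doubleton_eq_iff)
    then have "vertex_point y \<in> closed_cell {y, z}" "vertex_point z \<in> closed_cell {y, z}"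
      by (auto simp: closed_cell_def vertex_point_def indicator_def)
    then have "[vertex_point y, vertex_point z] \<in> pl_paths E (vertex_point y) (vertex_point z)"
      using step.hyps(2) by (auto simp: pl_paths_def)
    then show ?case using step.IH pl_paths_trans by blast
  qed
qed

lemma pl_paths_nonempty:
  assumes "connected_graph V E" "p \<in> realization V E" "q \<in> realization V E"
  shows "pl_paths E p q \<noteq> {}"
proof -
  obtain u where u: "u \<in> V" "pl_paths E p (vertex_point u) \<noteq> {}"
    using realization_cases assms by metis
  obtain v where v: "v \<in> V" "pl_paths E q (vertex_point v) \<noteq> {}"
    using realization_cases assms by metis
  show ?thesis
    using u v pl_paths_vertices[OF assms(1) u(1) v(1)] pl_paths_trans pl_paths_rev
    by (metis all_not_in_conv)
qed

lemma path_dist_ge_seg_length: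
  assumes "connected_graph V E" "p \<in> realization V E" "q \<in> realization V E"
  shows "seg_length p q \<le> path_dist E p q"
proof -
  have "finite {w. p w \<noteq> 0}"
    using assms(2) closed_cell_support(1) unfolding realization_def by blast
  then show ?thesis
    using pl_paths_nonempty[OF assms] pl_length_ge unfolding path_dist_def
    by (auto intro!: cINF_greatest)
qed

lemma path_dist_triangle:
  assumes "connected_graph V E" "p \<in> realization V E" "q \<in> realization V E" "r \<in> realization V E"
  shows "path_dist E p r \<le> path_dist E p q + path_dist E q r"
proof -
  have *: "path_dist E p r \<le> pl_length xs + pl_length ys"
    if "xs \<in> pl_paths E p q" "ys \<in> pl_paths E q r" for xs ys
    using pl_paths_trans[OF that] path_dist_le by force
  have "path_dist E p r - pl_length xs \<le> path_dist E q r" if "xs \<in> pl_paths E p q" for xs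
  proof -
    have "path_dist E p r - pl_length xs \<le> pl_length ys" if "ys \<in> pl_paths E q r" for ys
      using *[OF \<open>xs \<in> _\<close> that] by simp
    then show ?thesis
      using pl_paths_nonempty[OF assms(1,3,4)] unfolding path_dist_def[of E q r]
      by (auto intro!: cINF_greatest)
  qed
  then have "path_dist E p r - path_dist E q r \<le> pl_length xs" if "xs \<in> pl_paths E p q" for xs
    using that by (simp add: algebra_simps)
  then have "path_dist E p r - path_dist E q r \<le> path_dist E p q"
    using pl_paths_nonempty[OF assms(1,2,3)] unfolding path_dist_def[of E p q]
    by (auto intro!: cINF_greatest)
  then show ?thesis by simp
qed

theorem Metric_space_realization:
  assumes "connected_graph V E"
  shows "Metric_space (realization V E) (path_dist E)"
proof
  show "0 \<le> path_dist E p q" for p q by (rule path_dist_nonneg)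
  show "path_dist E p q = path_dist E q p" for p q
    by (intro antisym path_dist_commute_le)
  show "path_dist E p r \<le> path_dist E p q + path_dist E q r"
    if "p \<in> realization V E" "q \<in> realization V E" "r \<in> realization V E" for p q r
    using path_dist_triangle assms that by blast
  show "path_dist E p q = 0 \<longleftrightarrow> p = q"
    if "p \<in> realization V E" "q \<in> realization V E" for p q
  proof
    assume "path_dist E p q = 0"
    then have "\<not> seg_length p q > 0" using path_dist_ge_seg_length[OF assms that] by simp
    moreover have "finite {w. p w \<noteq> 0}" "finite {w. q w \<noteq> 0}"
      using that closed_cell_support(1) unfolding realization_def by blast+
    ultimately show "p = q" using seg_length_pos by blast
  next
    assume "p = q"
    then have "[p] \<in> pl_paths E p q" by (simp add: pl_paths_def)
    then show "path_dist E p q = 0"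
      using path_dist_le path_dist_nonneg[of E p q] by force
  qed
qed

corollary
  assumes "connected_graph V E"
  shows mspace_metric_graph: "mspace (metric_graph V E) = realization V E"
    and mdist_metric_graph: "mdist (metric_graph V E) = path_dist E"
  unfolding metric_graph_def
  using Metric_space_realization[OF assms]
  by (simp_all add: Metric_space.mspace_metric Metric_space.mdist_metric)

end

theory Submission
  imports Defs
begin

text \<open>
  Both conclusions rest on one fact about a connected graph with its hop distance: every
  interior vertex \<open>c\<close> of a geodesic from \<open>a\<close> to \<open>b\<close> lies in a minimal \<open>ab\<close>-separator
  (\<open>minimal_separator_through_geodesic_vertex\<close>). The sphere around \<open>a\<close> through \<open>c\<close> separates
  \<open>a\<close> from \<open>b\<close>, and trimming it to the vertices that touch both sides makes it minimal
  without losing \<open>c\<close>. If minimal separators have diameter at most \<open>m\<close>, then every connection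
  of \<open>a\<close> with \<open>b\<close> has a vertex within \<open>m\<close> of \<open>c\<close>.

  For the Bottleneck Property, a midpoint \<open>z\<close> of two points far from it is within \<open>1\<close>
  of an interior vertex \<open>c\<close> of such a geodesic, whose ends lie in the cells of the two points. A
  path that misses all cells spanned by a separator \<open>S\<close> stays in the union of the open stars of
  the other vertices, and the stars on the two sides of \<open>S\<close> are disjoint open sets; so by
  connectedness every path meets such a cell (\<open>path_meets_separator_cells\<close>). Passing from the
  cell to a vertex of \<open>S\<close> costs at most \<open>1\<close>, from there to \<open>c\<close> at most \<open>m\<close>, and from \<open>c\<close> to
  \<open>z\<close> at most \<open>1\<close>, which gives \<open>\<Delta> = m + 2\<close> (\<open>bottleneck_from_separator_bound\<close>).

  The tree is built directly from the layers of the graph around a root. Vertices of a layer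
  that are joined without coming closer to the root form a cluster, and
  the clusters form a tree because the lower neighbours of a cluster are all in one
  cluster. The discrete bottleneck bounds the diameter of a cluster by \<open>6 * m + 1\<close>
  (\<open>cluster_diameter\<close>), and then the collapse of every cluster to a chosen vertex of it
  is a quasi-isometry (\<open>quasi_isometric_cluster_tree\<close>). Since the nodes of the tree are vertices
  of the graph, the tree has the same type of vertices as the graph.
\<close>

section \<open>Components of induced subgraphs\<close>

lemma component_refl: "a \<in> W \<Longrightarrow> a \<in> component E W a"
  by (simp add: component_def)

lemma component_subset: "component E W a \<subseteq> W"
  by (auto simp: component_def)

lemma component_start: "b \<in> component E W a \<Longrightarrow> b \<in> W \<and> a \<in> W"
  unfolding component_def by (auto elim: converse_rtranclpE)

lemma component_step:
  "b \<in> component E W a \<Longrightarrow> {b, c} \<in> E \<Longrightarrow> c \<in> W \<Longrightarrow> c \<in> component E W a"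
  unfolding component_def by (auto intro: rtranclp.rtrancl_into_rtrancl)

lemma component_mono: "W \<subseteq> W' \<Longrightarrow> component E W a \<subseteq> component E W' a"
proof -
  assume "W \<subseteq> W'"
  then have "(\<lambda>u v. u \<in> W \<and> v \<in> W \<and> {u, v} \<in> E)\<^sup>*\<^sup>* \<le> (\<lambda>u v. u \<in> W' \<and> v \<in> W' \<and> {u, v} \<in> E)\<^sup>*\<^sup>*"
    by (intro rtranclp_mono) blast
  then show ?thesis using \<open>W \<subseteq> W'\<close> unfolding component_def by blast
qed

lemma component_trans:
  "b \<in> component E W a \<Longrightarrow> c \<in> component E W b \<Longrightarrow> c \<in> component E W a"
  unfolding component_def by auto

lemma component_sym: "b \<in> component E W a \<Longrightarrow> a \<in> component E W b"
proof -
  assume b: "b \<in> component E W a"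
  have "symp (\<lambda>u v. u \<in> W \<and> v \<in> W \<and> {u, v} \<in> E)"
    by (auto simp: symp_def insert_commute)
  then have "symp (\<lambda>u v. u \<in> W \<and> v \<in> W \<and> {u, v} \<in> E)\<^sup>*\<^sup>*"
    by (rule symp_rtranclp)
  moreover have "(\<lambda>u v. u \<in> W \<and> v \<in> W \<and> {u, v} \<in> E)\<^sup>*\<^sup>* a b"
    using b by (simp add: component_def)
  ultimately have "(\<lambda>u v. u \<in> W \<and> v \<in> W \<and> {u, v} \<in> E)\<^sup>*\<^sup>* b a"
    by (rule sympD)
  then show ?thesis using component_start[OF b] by (simp add: component_def)
qed

lemma component_eq: "b \<in> component E W a \<Longrightarrow> component E W a = component E W b"
  by (auto intro: component_trans dest: component_trans[OF component_sym])

lemma component_induct [consumes 1, case_names start step]: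
  assumes "b \<in> component E W a"
    and "P a"
    and "\<And>u v. u \<in> component E W a \<Longrightarrow> P u \<Longrightarrow> v \<in> W \<Longrightarrow> {u, v} \<in> E \<Longrightarrow> P v"
  shows "P b"
proof -
  have aW: "a \<in> W" using component_start[OF assms(1)] by simp
  have "(\<lambda>u v. u \<in> W \<and> v \<in> W \<and> {u, v} \<in> E)\<^sup>*\<^sup>* a b"
    using assms(1) by (simp add: component_def)
  then have "b \<in> component E W a \<and> P b"
  proof induction
    case base
    then show ?case using assms(2) component_refl[OF aW] by simp
  next
    case (step y z)
    then show ?case using assms(3) component_step[of y E W a z] by blast
  qed
  then show ?thesis by simp
qed


section \<open>Trees from parent functions\<close>

text \<open>
  A cycle would contain a vertex of maximal level. Its two neighbours on the
  cycle are not of higher level, so both are its parent, although they are distinct.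
\<close>

lemma tree_of_parent:
  fixes lev :: "'v \<Rightarrow> nat"
  assumes r: "r \<in> V" and par: "\<And>x. x \<in> V \<Longrightarrow> x \<noteq> r \<Longrightarrow> par x \<in> V \<and> lev (par x) < lev x"
  shows "tree_graph V {{x, par x} | x. x \<in> V - {r}}"
proof -
  let ?E = "{{x, par x} | x. x \<in> V - {r}}"
  have edge: "y = par x" if "{x, y} \<in> ?E" "lev y \<le> lev x" for x y
  proof -
    obtain t where t: "t \<in> V" "t \<noteq> r" "{x, y} = {t, par t}" using \<open>{x, y} \<in> ?E\<close> by blast
    then show ?thesis using par[OF t(1,2)] that(2) by (auto simp: doubleton_eq_iff)
  qed
  have root: "r \<in> component ?E V x" if "x \<in> V" for x
    using that
  proof (induction "lev x" arbitrary: x rule: less_induct)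
    case less
    show ?case
    proof (cases "x = r")
      case True
      then show ?thesis using component_refl[OF r] by simp
    next
      case False
      then have p: "par x \<in> V" "lev (par x) < lev x" using par less.prems by auto
      have "{x, par x} \<in> ?E" using False less.prems by blast
      from component_step[OF component_refl[OF less.prems] this p(1)]
      show ?thesis using less.hyps[OF p(2,1)] by (rule component_trans)
    qed
  qed
  have "simple_graph V ?E" unfolding simple_graph_def
  proof
    fix e
    assume "e \<in> ?E"
    then obtain x where x: "e = {x, par x}" "x \<in> V" "x \<noteq> r" by blast
    then have "par x \<in> V" "x \<noteq> par x" using par[of x] by auto
    then show "\<exists>u\<in>V. \<exists>v\<in>V. u \<noteq> v \<and> e = {u, v}" using x by blast
  qed
  moreover have "b \<in> component ?E V a" if "a \<in> V" "b \<in> V" for a b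
    by (rule component_trans[OF root[OF that(1)] component_sym[OF root[OF that(2)]]])
  moreover have "V \<noteq> {}" using r by blast
  ultimately have conn: "connected_graph V ?E" unfolding connected_graph_def by (intro conjI ballI)
  define F where "F = ?E"
  have edge_F: "y = par x" if "{x, y} \<in> F" "lev y \<le> lev x" for x y
    using edge that unfolding F_def by blast
  have no_cycle: "\<not> is_cycle F vs" for vs
  proof
    assume "is_cycle F vs"
    then have len: "length vs \<ge> 3" and dist: "distinct vs"
      and succ: "\<And>i. Suc i < length vs \<Longrightarrow> {vs ! i, vs ! Suc i} \<in> F"
      and close: "{last vs, hd vs} \<in> F"
      unfolding is_cycle_def successively_conv_nth by auto
    have wrap: "{vs ! (length vs - 1), vs ! 0} \<in> F"
    proof -
      have "vs \<noteq> []" using len by auto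
      then show ?thesis using close by (simp add: hd_conv_nth last_conv_nth)
    qed
    have "finite (lev ` set vs)" "lev ` set vs \<noteq> {}" using len by auto
    then have "Max (lev ` set vs) \<in> lev ` set vs" by (rule Max_in)
    then obtain i where i: "i < length vs" "lev (vs ! i) = Max (lev ` set vs)"
      by (metis imageE in_set_conv_nth)
    have max: "lev (vs ! j) \<le> lev (vs ! i)" if "j < length vs" for j
      unfolding i(2) using that by (intro Max_ge) auto
    define j where "j = (if Suc i = length vs then 0 else Suc i)"
    define k where "k = (if i = 0 then length vs - 1 else i - 1)"
    have jk: "j < length vs" "k < length vs" "j \<noteq> k"
      using i(1) len unfolding j_def k_def by auto
    have "{vs ! i, vs ! j} \<in> F"
    proof (cases "Suc i = length vs")
      case True
      then have "i = length vs - 1" "j = 0" by (simp_all add: j_def)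
      then show ?thesis using wrap by simp
    next
      case False
      then show ?thesis using succ[of i] i(1) by (simp add: j_def)
    qed
    moreover have "{vs ! i, vs ! k} \<in> F"
    proof (cases i)
      case 0
      then show ?thesis using wrap by (simp add: k_def insert_commute)
    next
      case (Suc i')
      then show ?thesis using succ[of i'] i(1) by (simp add: k_def insert_commute)
    qed
    ultimately have "vs ! j = vs ! k" using edge_F max jk by metis
    then show False using nth_eq_iff_index_eq[OF dist] jk by blast
  qed
  show ?thesis using conn no_cycle unfolding tree_graph_def F_def by blast
qed


section \<open>The hop distance of a connected graph\<close>

definition hop :: "'v set set \<Rightarrow> 'v \<Rightarrow> 'v \<Rightarrow> nat" where
  "hop E u v = (LEAST n. ((\<lambda>x y. {x, y} \<in> E) ^^ n) u v)"

locale conn_graph =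
  fixes V :: "'v set" and E :: "'v set set"
  assumes conn: "connected_graph V E"
begin

lemma edge_vertices: "{u, v} \<in> E \<Longrightarrow> u \<in> V \<and> v \<in> V \<and> u \<noteq> v"
  using conn unfolding connected_graph_def simple_graph_def
  by (metis doubleton_eq_iff)

lemma edge_cases:
  assumes "e \<in> E"
  obtains u v where "u \<in> V" "v \<in> V" "u \<noteq> v" "e = {u, v}"
  using assms conn unfolding connected_graph_def simple_graph_def by blast

lemma hop_le: "((\<lambda>x y. {x, y} \<in> E) ^^ n) u v \<Longrightarrow> hop E u v \<le> n"
  unfolding hop_def by (rule Least_le)

lemma hop_walk:
  assumes "u \<in> V" "v \<in> V"
  shows "((\<lambda>x y. {x, y} \<in> E) ^^ hop E u v) u v"
proof -
  have "(\<lambda>u v. u \<in> V \<and> v \<in> V \<and> {u, v} \<in> E)\<^sup>*\<^sup>* u v"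
    using conn assms by (auto simp: connected_graph_def component_def)
  then have "(\<lambda>x y. {x, y} \<in> E)\<^sup>*\<^sup>* u v"
    by (rule rtranclp_mono[THEN predicate2D, rotated]) auto
  then obtain n where "((\<lambda>x y. {x, y} \<in> E) ^^ n) u v"
    by (auto dest: rtranclp_imp_relpowp)
  then show ?thesis unfolding hop_def by (rule LeastI)
qed

lemma hop_self [simp]: "hop E u u = 0"
  using hop_le[of 0 u u] by simp

lemma hop_eq_0: "u \<in> V \<Longrightarrow> v \<in> V \<Longrightarrow> hop E u v = 0 \<longleftrightarrow> u = v"
  using hop_walk[of u v] by auto

lemma hop_triangle:
  assumes "u \<in> V" "v \<in> V" "w \<in> V"
  shows "hop E u w \<le> hop E u v + hop E v w"
  using hop_walk[OF assms(1,2)] hop_walk[OF assms(2,3)]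
  by (intro hop_le) (auto simp: relpowp_add)

lemma hop_commute: "hop E u v = hop E v u"
proof -
  have "((\<lambda>x y. {x, y} \<in> E) ^^ n) v u" if "((\<lambda>x y. {x, y} \<in> E) ^^ n) u v" for n u v
    using that
  proof (induction n arbitrary: v)
    case (Suc n)
    then obtain w where "((\<lambda>x y. {x, y} \<in> E) ^^ n) u w" "{w, v} \<in> E" by auto
    then have "((\<lambda>x y. {x, y} \<in> E) ^^ n) w u" "{v, w} \<in> E"
      using Suc.IH by (auto simp: insert_commute)
    then show ?case by (intro relpowp_Suc_I2)
  qed simp
  then show ?thesis unfolding hop_def by metis
qed

lemma hop_edge: "{u, v} \<in> E \<Longrightarrow> hop E u v \<le> 1"
  by (rule hop_le) auto

lemma hop_edge_le: "{u, v} \<in> E \<Longrightarrow> w \<in> V \<Longrightarrow> hop E w v \<le> hop E w u + 1"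
  using hop_triangle[of w u v] hop_edge[of u v] edge_vertices[of u v] by auto

lemma hop_pred:
  assumes "u \<in> V" "v \<in> V" "hop E u v = Suc n"
  obtains w where "w \<in> V" "{w, v} \<in> E" "hop E u w = n"
proof -
  obtain w where w: "((\<lambda>x y. {x, y} \<in> E) ^^ n) u w" "{w, v} \<in> E"
    using hop_walk[OF assms(1,2)] assms(3) by auto
  then have "hop E u w \<le> n" "w \<in> V" using hop_le edge_vertices by blast+
  then show thesis using that[of w] w hop_edge_le[OF w(2) assms(1)] assms(3) by simp
qed

lemma geodesic_vertex_at:
  assumes "u \<in> V" "v \<in> V" "k \<le> hop E u v"
  obtains c where "c \<in> V" "hop E u c = k" "hop E c v = hop E u v - k"
proof -
  have "((\<lambda>x y. {x, y} \<in> E) ^^ (k + (hop E u v - k))) u v"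
    using hop_walk[OF assms(1,2)] assms(3) by simp
  then obtain c where c: "((\<lambda>x y. {x, y} \<in> E) ^^ k) u c"
      "((\<lambda>x y. {x, y} \<in> E) ^^ (hop E u v - k)) c v"
    unfolding relpowp_add by auto
  have "c \<in> V"
    using c(1) assms(1) edge_vertices by (cases k) auto
  moreover have "hop E u c \<le> k" "hop E c v \<le> hop E u v - k" using c hop_le by auto
  ultimately show thesis
    using that[of c] hop_triangle[OF assms(1) \<open>c \<in> V\<close> assms(2)] assms(3) by simp
qed

lemma interval_connected:
  assumes "u \<in> V" "v \<in> V" "w \<in> V" "hop E u w + hop E w v = hop E u v"
  shows "w \<in> component E {x \<in> V. hop E u x + hop E x v = hop E u v} u"
  using assms(3,4)
proof (induction "hop E u w" arbitrary: w)
  case 0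
  then show ?case using assms hop_eq_0[of u w] by (auto intro: component_refl)
next
  case (Suc n)
  obtain x where x: "x \<in> V" "{x, w} \<in> E" "hop E u x = n"
    using hop_pred[OF assms(1) Suc.prems(1)] Suc.hyps(2) by metis
  have "hop E x v \<le> hop E w v + 1"
    using hop_edge_le[of w x v] x(2) assms(2) by (simp add: hop_commute insert_commute)
  then have "hop E u x + hop E x v = hop E u v"
    using hop_triangle[OF assms(1) x(1) assms(2)] Suc.prems(2) Suc.hyps(2) x(3) by simp
  then have "x \<in> component E {x \<in> V. hop E u x + hop E x v = hop E u v} u"
    using Suc.hyps(1) x by blast
  then show ?case using component_step[OF _ x(2)] Suc.prems by simp
qed


section \<open>Minimal separators through a vertex of a geodesic\<close>

lemma separator_meets_connecting_set:
  assumes "separates V E S a b" "W \<subseteq> V" "b \<in> component E W a"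
  shows "W \<inter> S \<noteq> {}"
proof
  assume "W \<inter> S = {}"
  then have "b \<in> component E (V - S) a"
    using component_mono[of W "V - S" E a] assms(2,3) by blast
  then show False using component_eq assms(1) unfolding separates_def by metis
qed

text \<open>
  The sphere around \<open>a\<close> through \<open>c\<close> separates \<open>a\<close> from \<open>b\<close>. Shrinking it first to the
  vertices that touch the side of \<open>b\<close>, and these to the vertices that touch the side of \<open>a\<close>,
  leaves a set each of whose vertices touches both sides, hence a minimal separator. The vertex
  \<open>c\<close> survives because the two halves of a geodesic through \<open>c\<close> stay on their sides of the
  sphere. Shrinking in this way, and not by deleting superfluous vertices one at a
  time, works for infinite spheres as well and keeps the chosen vertex.
\<close>

lemma minimal_separator_through_geodesic_vertex:
  assumes V: "a \<in> V" "b \<in> V" "c \<in> V"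
    and geo: "hop E a c + hop E c b = hop E a b" and "c \<noteq> a" "c \<noteq> b"
  shows "\<exists>S. minimal_ab_separator V E S a b \<and> c \<in> S"
proof -
  define k where "k = hop E a c"
  have k: "0 < k" "k < hop E a b"
    using hop_eq_0[of a c] hop_eq_0[of c b] assms unfolding k_def by auto
  define sphere where "sphere = {v \<in> V. hop E a v = k}"
  define B where "B = component E (V - sphere) b"
  define S1 where "S1 = {v \<in> sphere. \<exists>w\<in>B. {v, w} \<in> E}"
  define A where "A = component E (V - S1) a"
  define S where "S = {v \<in> S1. \<exists>w\<in>A. {v, w} \<in> E}"
  have sub: "S \<subseteq> S1" "S1 \<subseteq> sphere" "sphere \<subseteq> V"
    by (auto simp: S_def S1_def sphere_def)
  have a: "a \<in> V - S1" and b: "b \<in> V - sphere"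
    using V k sub by (auto simp: sphere_def)

  \<comment> \<open>Levels change by at most \<open>1\<close> along an edge, so the side of \<open>b\<close> cannot cross level \<open>k\<close>.\<close>
  have B_far: "k < hop E a w" if "w \<in> B" for w
    using that unfolding B_def
  proof (induction rule: component_induct)
    case start
    then show ?case using k by simp
  next
    case (step u v)
    then have "hop E a u \<le> hop E a v + 1" "hop E a v \<noteq> k"
      using hop_edge_le[of v u a] V by (auto simp: insert_commute sphere_def)
    then show ?case using step by simp
  qed
  have "w \<notin> B" if "w \<in> A" for w
    using that unfolding A_def
  proof (induction rule: component_induct)
    case start
    then show ?case using B_far[of a] by auto
  next
    case (step u v)
    show ?case
    proof
      assume v: "v \<in> B"
      have u: "u \<in> V - S1" using step(1) component_subset[of E "V - S1" a] by blast
      have "u \<in> sphere"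
        using component_step[of v E "V - sphere" b u] v step u
        unfolding B_def by (auto simp: insert_commute)
      then show False using u v step by (auto simp: S1_def)
    qed
  qed
  then have "b \<notin> A" using component_refl[OF b] unfolding B_def by blast
  have "w \<in> A" if "w \<in> component E (V - S) a" for w
    using that
  proof (induction rule: component_induct)
    case start
    then show ?case unfolding A_def using a by (rule component_refl)
  next
    case (step u v)
    then have "v \<notin> S1" unfolding S_def by (auto simp: insert_commute)
    then show ?case using step component_step[of u E "V - S1" a v] unfolding A_def by blast
  qed
  then have sep: "separates V E S a b"
    using \<open>b \<notin> A\<close> a b sub component_refl[of b "V - S" E]
    unfolding separates_def by blast

  have B_near: "w \<in> B" if "w \<in> V" "hop E w b < hop E c b" for w
    using that
  proof (induction "hop E w b" arbitrary: w)
    case 0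
    then show ?case using hop_eq_0[of w b] V component_refl[OF b] unfolding B_def by simp
  next
    case (Suc n)
    obtain x where x: "x \<in> V" "{x, w} \<in> E" "hop E x b = n"
      using hop_pred[OF V(2) Suc.prems(1)] Suc.hyps(2) by (metis hop_commute)
    have "x \<in> B" using Suc x by auto
    moreover have "w \<in> V - sphere"
      using hop_triangle[of a w b] geo Suc.prems V unfolding sphere_def k_def by auto
    ultimately show ?case using component_step[OF _ x(2)] unfolding B_def by blast
  qed
  have A_near: "w \<in> A" if "w \<in> V" "hop E a w < k" for w
    using that
  proof (induction "hop E a w" arbitrary: w)
    case 0
    then show ?case using hop_eq_0[of a w] V component_refl[OF a] unfolding A_def by simp
  next
    case (Suc n)
    obtain x where x: "x \<in> V" "{x, w} \<in> E" "hop E a x = n"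
      using hop_pred[OF V(1) Suc.prems(1)] Suc.hyps(2) by metis
    have "x \<in> A" using Suc x by auto
    moreover have "w \<in> V - S1" using Suc.prems sub unfolding sphere_def by auto
    ultimately show ?case using component_step[OF _ x(2)] unfolding A_def by blast
  qed
  obtain n where n: "hop E b c = Suc n"
    using hop_eq_0[of b c] V \<open>c \<noteq> b\<close> not0_implies_Suc by metis
  obtain w where w: "w \<in> V" "{w, c} \<in> E" "hop E b w = n" using hop_pred[OF V(2,3) n] .
  have "w \<in> B" using B_near[OF w(1)] w(3) n by (simp add: hop_commute)
  then have "c \<in> S1" using w V unfolding S1_def sphere_def k_def by (auto simp: insert_commute)
  moreover obtain n' where n': "hop E a c = Suc n'" using k unfolding k_def by (cases "hop E a c") auto
  obtain w' where w': "w' \<in> V" "{w', c} \<in> E" "hop E a w' = n'" using hop_pred[OF V(1,3) n'] .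
  have "w' \<in> A" using A_near[OF w'(1)] w'(3) n' by (simp add: k_def)
  ultimately have "c \<in> S" using w' unfolding S_def by (auto simp: insert_commute)

  moreover have "\<not> separates V E T a b" if T: "T \<subset> S" for T
  proof -
    obtain s where s: "s \<in> S" "s \<notin> T" using T by blast
    then obtain u v where uv: "u \<in> A" "{s, u} \<in> E" "v \<in> B" "{s, v} \<in> E"
      unfolding S_def S1_def by blast
    have "A \<subseteq> component E (V - T) a" "B \<subseteq> component E (V - T) b"
      unfolding A_def B_def using T sub by (auto intro!: component_mono)
    moreover have "s \<in> V - T" using s sub by blast
    moreover have "{u, s} \<in> E" "{v, s} \<in> E" using uv by (simp_all add: insert_commute)
    ultimately have "s \<in> component E (V - T) a" "s \<in> component E (V - T) b"
      using component_step[of u E "V - T" a s] component_step[of v E "V - T" b s] uv by blast+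
    then have "component E (V - T) a = component E (V - T) b"
      using component_eq[of s E "V - T"] by metis
    then show ?thesis by (simp add: separates_def)
  qed
  ultimately show ?thesis using sep unfolding minimal_ab_separator_def by blast
qed

text \<open>The discrete bottleneck: a detour between the ends of a geodesic cannot avoid its middle.\<close>

lemma connecting_set_near_geodesic:
  assumes bound: "\<And>S s t. minimal_vertex_separator V E S \<Longrightarrow> s \<in> S \<Longrightarrow> t \<in> S \<Longrightarrow> hop E s t \<le> m"
    and V: "a \<in> V" "b \<in> V" "c \<in> V"
    and geo: "hop E a c + hop E c b = hop E a b" "c \<noteq> a" "c \<noteq> b"
    and W: "W \<subseteq> V" "b \<in> component E W a"
  shows "\<exists>w\<in>W. hop E c w \<le> m"
proof -
  obtain S where S: "minimal_ab_separator V E S a b" "c \<in> S"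
    using minimal_separator_through_geodesic_vertex[OF V geo] by blast
  then have "separates V E S a b" "minimal_vertex_separator V E S"
    using V unfolding minimal_vertex_separator_def minimal_ab_separator_def by auto
  then show ?thesis
    using separator_meets_connecting_set[OF _ W] S(2) bound by blast
qed


section \<open>Distances in the realization\<close>

lemma vertex_point_apply: "vertex_point v w = (if w = v then 1 else 0)"
  by (simp add: vertex_point_def)

lemma vertex_in_cell: "v \<in> e \<Longrightarrow> finite e \<Longrightarrow> vertex_point v \<in> closed_cell e"
  by (auto simp: closed_cell_def vertex_point_apply)

lemma vertex_point_realization: "v \<in> V \<Longrightarrow> vertex_point v \<in> realization V E"
  by (auto simp: realization_def closed_cell_singleton)

lemma edge_cell_realization: "e \<in> E \<Longrightarrow> p \<in> closed_cell e \<Longrightarrow> p \<in> realization V E"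
  by (auto simp: realization_def)

lemma finite_edge: "e \<in> E \<Longrightarrow> finite e"
  by (erule edge_cases) simp

lemma finite_support: "p \<in> realization V E \<Longrightarrow> finite {w. p w \<noteq> 0}"
  using closed_cell_support(1) unfolding realization_def by blast

lemma closed_cell_pair:
  "u \<noteq> v \<Longrightarrow> p \<in> closed_cell {u, v} \<longleftrightarrow>
     0 \<le> p u \<and> 0 \<le> p v \<and> p u + p v = 1 \<and> (\<forall>w. w \<noteq> u \<longrightarrow> w \<noteq> v \<longrightarrow> p w = 0)"
  unfolding closed_cell_def by (simp, safe; metis order_refl)

lemma seg_length_pair:
  assumes "u \<noteq> v" "p \<in> closed_cell {u, v}" "q \<in> closed_cell {u, v}"
  shows "seg_length p q = \<bar>p u - q u\<bar>"
proof -
  have "seg_length p q = (\<bar>p u - q u\<bar> + \<bar>p v - q v\<bar>) / 2"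
    using assms by (subst seg_length_superset[of "{u, v}"]) (auto simp: closed_cell_pair)
  moreover have "\<bar>p v - q v\<bar> = \<bar>p u - q u\<bar>"
    using assms by (auto simp: closed_cell_pair)
  ultimately show ?thesis by simp
qed

lemma seg_length_cell_le_1:
  assumes "e \<in> E" "p \<in> closed_cell e" "q \<in> closed_cell e"
  shows "seg_length p q \<le> 1"
proof -
  obtain u v where uv: "u \<noteq> v" "e = {u, v}" using edge_cases[OF assms(1)] by metis
  show ?thesis
    using seg_length_pair[OF uv(1)] assms(2,3) unfolding uv(2)
    by (auto simp: closed_cell_pair[OF uv(1)])
qed

lemma path_dist_cell_le:
  assumes "e \<in> E" "p \<in> closed_cell e" "q \<in> closed_cell e"
  shows "path_dist E p q \<le> seg_length p q"
proof -
  have "[p, q] \<in> pl_paths E p q" using assms by (auto simp: pl_paths_def)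
  from path_dist_le[OF this] show ?thesis by simp
qed

lemma path_dist_commute: "path_dist E p q = path_dist E q p"
  by (intro antisym path_dist_commute_le)

lemma path_dist_self: "path_dist E p p = 0"
proof -
  have "[p] \<in> pl_paths E p p" by (simp add: pl_paths_def)
  from path_dist_le[OF this] path_dist_nonneg[of E p p] show ?thesis by simp
qed

lemma cell_point_support:
  assumes "e \<in> E" "p \<in> closed_cell e" "\<nexists>v. v \<in> e \<and> p = vertex_point v"
  shows "{v. p v > 0} = e"
proof -
  obtain u v where e: "u \<noteq> v" "e = {u, v}" using edge_cases[OF assms(1)] by metis
  note p = assms(2)[unfolded e(2) closed_cell_pair[OF e(1)]]
  have "p u \<noteq> 0"
  proof
    assume "p u = 0"
    then have "p = vertex_point v" using p e(1) by (auto simp: fun_eq_iff vertex_point_apply)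
    then show False using assms(3) e by auto
  qed
  moreover have "p v \<noteq> 0"
  proof
    assume "p v = 0"
    then have "p = vertex_point u" using p e(1) by (auto simp: fun_eq_iff vertex_point_apply)
    then show False using assms(3) e by auto
  qed
  ultimately show ?thesis using p e by force
qed

lemma support_vertex:
  assumes "p \<in> realization V E" "p v > 0"
  shows "v \<in> V" "path_dist E p (vertex_point v) \<le> seg_length p (vertex_point v)"
    "path_dist E p (vertex_point v) \<le> 1"
proof -
  from assms(1) consider w where "w \<in> V" "p = vertex_point w" | e where "e \<in> E" "p \<in> closed_cell e"
    by (auto simp: realization_def closed_cell_singleton)
  then have "v \<in> V \<and> path_dist E p (vertex_point v) \<le> seg_length p (vertex_point v) \<and>
    path_dist E p (vertex_point v) \<le> 1"
  proof cases
    case 1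
    then have "w = v" using assms(2) by (simp add: vertex_point_apply split: if_splits)
    then show ?thesis using 1 by (simp add: path_dist_self)
  next
    case 2
    have "v \<in> e" using 2 assms(2) by (auto simp: closed_cell_def)
    then have "v \<in> V" "vertex_point v \<in> closed_cell e"
      using edge_cases[OF 2(1)] vertex_in_cell[OF _ finite_edge[OF 2(1)]] by blast+
    moreover from this have "path_dist E p (vertex_point v) \<le> seg_length p (vertex_point v)"
      "seg_length p (vertex_point v) \<le> 1"
      using path_dist_cell_le[OF 2] seg_length_cell_le_1[OF 2] by blast+
    ultimately show ?thesis by simp
  qed
  then show "v \<in> V" "path_dist E p (vertex_point v) \<le> seg_length p (vertex_point v)"
    "path_dist E p (vertex_point v) \<le> 1" by auto
qed

lemma support_nonempty:
  assumes "p \<in> realization V E"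
  shows "\<exists>v. p v > 0"
  using assms closed_cell_support(2) unfolding realization_def by blast

text \<open>
  A function on the vertices that varies by at most \<open>1\<close> along every edge extends linearly over
  the edges to a \<open>1\<close>-Lipschitz function on the realization. Applied to the hop distance from
  a vertex this bounds the length metric from below.
\<close>

lemma linear_extension_Lipschitz:
  fixes f :: "'v \<Rightarrow> real"
  assumes f: "\<And>u v. {u, v} \<in> E \<Longrightarrow> f v \<le> f u + 1"
    and "xs \<in> pl_paths E p q"
  shows "(\<Sum>w | q w \<noteq> 0. q w * f w) - (\<Sum>w | p w \<noteq> 0. p w * f w) \<le> pl_length xs"
proof -
  define F where "F = (\<lambda>p::'v \<Rightarrow> real. \<Sum>w | p w \<noteq> 0. p w * f w)"
  have F_cell: "F y - F x \<le> seg_length x y"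
    if e: "e \<in> E" "x \<in> closed_cell e" "y \<in> closed_cell e" for e x y
  proof -
    obtain u v where uv: "u \<noteq> v" "e = {u, v}" using edge_cases[OF e(1)] by metis
    have F_pair: "F z = z u * f u + (1 - z u) * f v" if z: "z \<in> closed_cell {u, v}" for z
    proof -
      have "F z = (\<Sum>w\<in>{u, v}. z w * f w)"
        unfolding F_def using z by (intro sum.mono_neutral_left) (auto simp: closed_cell_pair[OF uv(1)])
      moreover have "z v = 1 - z u" using z by (simp add: closed_cell_pair[OF uv(1)])
      ultimately show ?thesis using uv(1) by simp
    qed
    have "F y - F x = (y u - x u) * (f u - f v)"
      using F_pair[of x] F_pair[of y] e(2,3) unfolding uv(2) by (simp add: algebra_simps)
    also have "\<dots> \<le> \<bar>y u - x u\<bar> * \<bar>f u - f v\<bar>"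
      by (metis abs_ge_self abs_mult)
    also have "\<dots> \<le> \<bar>y u - x u\<bar> * 1"
      using f[of u v] f[of v u] e(1) unfolding uv(2)
      by (intro mult_left_mono) (auto simp: insert_commute)
    also have "\<dots> = seg_length x y"
      using seg_length_pair[OF uv(1)] e(2,3) unfolding uv(2) by (simp add: abs_minus_commute)
    finally show ?thesis .
  qed
  have "F q - F p \<le> pl_length xs"
    using assms(2)
  proof (induction xs arbitrary: p)
    case Nil
    then show ?case by (simp add: pl_paths_def)
  next
    case (Cons x xs)
    show ?case
    proof (cases xs)
      case Nil
      then show ?thesis using Cons.prems by (auto simp: pl_paths_def)
    next
      case (Cons y ys)
      obtain e where e: "e \<in> E" "p \<in> closed_cell e" "y \<in> closed_cell e" "x = p"
        and xs: "xs \<in> pl_paths E y q"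
        using Cons.prems \<open>xs = y # ys\<close> by (auto simp: pl_paths_def)
      have "F q - F y \<le> pl_length xs" using Cons.IH xs by blast
      then show ?thesis using F_cell[OF e(1-3)] e(4) \<open>xs = y # ys\<close> by simp
    qed
  qed
  then show ?thesis by (simp add: F_def)
qed

lemma path_dist_vertices:
  assumes "u \<in> V" "v \<in> V"
  shows "path_dist E (vertex_point u) (vertex_point v) = real (hop E u v)"
proof (rule antisym)
  have "path_dist E (vertex_point u) (vertex_point v) \<le> real n"
    if "((\<lambda>x y. {x, y} \<in> E) ^^ n) u v" for n v
    using that
  proof (induction n arbitrary: v)
    case 0
    then show ?case by (simp add: path_dist_self)
  next
    case (Suc n)
    then obtain w where w: "((\<lambda>x y. {x, y} \<in> E) ^^ n) u w" "{w, v} \<in> E" by auto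
    have "path_dist E (vertex_point w) (vertex_point v) \<le> 1"
      using path_dist_cell_le[OF w(2)] seg_length_cell_le_1[OF w(2)]
        vertex_in_cell[of w "{w, v}"] vertex_in_cell[of v "{w, v}"] by force
    then show ?case
      using path_dist_triangle[OF conn vertex_point_realization[OF assms(1)]
          vertex_point_realization[of w] vertex_point_realization[of v]]
        edge_vertices[OF w(2)] Suc.IH[OF w(1)] by simp
  qed
  then show "path_dist E (vertex_point u) (vertex_point v) \<le> real (hop E u v)"
    using hop_walk[OF assms] by blast
next
  let ?f = "\<lambda>w. real (hop E u w)"
  have val: "(\<Sum>w | vertex_point x w \<noteq> (0::real). vertex_point x w * ?f w) = ?f x" for x
    by (simp add: vertex_point_apply)
  have "?f v \<le> pl_length xs" if "xs \<in> pl_paths E (vertex_point u) (vertex_point v)" for xs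
  proof -
    have "?f w \<le> ?f x + 1" if "{x, w} \<in> E" for x w
      using hop_edge_le[OF that assms(1)] by simp
    from linear_extension_Lipschitz[of ?f, OF this \<open>xs \<in> _\<close>] show ?thesis
      unfolding val by simp
  qed
  then show "?f v \<le> path_dist E (vertex_point u) (vertex_point v)"
    using pl_paths_vertices[OF conn assms] unfolding path_dist_def
    by (auto intro!: cINF_greatest)
qed

text \<open>
  Two different cells meet in a vertex at most, so a piecewise linear path from \<open>p\<close> passes
  through an end vertex of the cell of \<open>p\<close> unless its break points never change the cell; in
  that case the triangle inequality for \<open>seg_length\<close> replaces the path by a single segment.
\<close>

lemma pl_path_exit:
  assumes "xs \<in> pl_paths E p q" "p \<in> realization V E"
  shows "(\<exists>e\<in>E. p \<in> closed_cell e \<and> q \<in> closed_cell e \<and> seg_length p q \<le> pl_length xs) \<or>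
    (\<exists>v. p v > 0 \<and> seg_length p (vertex_point v) + path_dist E (vertex_point v) q \<le> pl_length xs)"
  using assms
proof (induction xs arbitrary: p)
  case Nil
  then show ?case by (simp add: pl_paths_def)
next
  case (Cons x xs)
  show ?case
  proof (cases "\<exists>v. p = vertex_point v")
    case True
    then obtain v where v: "p = vertex_point v" by blast
    then have "p v > 0" by (simp add: vertex_point_apply)
    moreover have "seg_length p (vertex_point v) + path_dist E (vertex_point v) q \<le> pl_length (x # xs)"
      using path_dist_le[OF Cons.prems(1)] v by simp
    ultimately show ?thesis by blast
  next
    case not_vertex: False
    show ?thesis
    proof (cases xs)
      case Nil
      then have "p = q" using Cons.prems(1) by (auto simp: pl_paths_def)
      moreover obtain e where "e \<in> E" "p \<in> closed_cell e"
        using Cons.prems(2) not_vertex by (auto simp: realization_def closed_cell_singleton)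
      ultimately show ?thesis using pl_length_nonneg[of "x # xs"] by auto
    next
      case (Cons y ys)
      obtain e where e: "e \<in> E" "p \<in> closed_cell e" "y \<in> closed_cell e" "x = p"
        and xs: "xs \<in> pl_paths E y q"
        using Cons.prems \<open>xs = y # ys\<close> by (auto simp: pl_paths_def)
      have len: "pl_length (x # xs) = seg_length p y + pl_length xs"
        using e(4) \<open>xs = y # ys\<close> by simp
      have p_pos: "p v > 0" if "v \<in> e" for v
        using cell_point_support[OF e(1,2)] not_vertex that by blast
      have y: "y \<in> realization V E" using edge_cell_realization[OF e(1,3)] .
      consider e' where "e' \<in> E" "y \<in> closed_cell e'" "q \<in> closed_cell e'" "seg_length y q \<le> pl_length xs"
        | v where "y v > 0" "seg_length y (vertex_point v) + path_dist E (vertex_point v) q \<le> pl_length xs"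
        using Cons.IH[OF xs y] by blast
      then show ?thesis
      proof cases
        case 1
        show ?thesis
        proof (cases "e = e'")
          case True
          have "seg_length p q \<le> seg_length p y + seg_length y q"
            using closed_cell_support(1)[OF e(2)] closed_cell_support(1)[OF e(3)]
              closed_cell_support(1)[OF 1(3)] by (intro seg_length_triangle)
          then show ?thesis using len e 1 True by force
        next
          case False
          obtain v where y_v: "y = vertex_point v"
            using cell_point_support[OF e(1,3)] cell_point_support[OF 1(1,2)] False by metis
          have "v \<in> e"
          proof (rule ccontr)
            assume "v \<notin> e"
            then have "y v = 0" using e(3) by (simp add: closed_cell_def)
            then show False using y_v by (simp add: vertex_point_apply)
          qed
          note v = this y_v
          have "seg_length p (vertex_point v) + path_dist E (vertex_point v) q \<le> pl_length (x # xs)"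
            using path_dist_le[OF xs] len v by simp
          then show ?thesis using p_pos v by blast
        qed
      next
        case 2
        have "v \<in> e" using 2(1) e(3) by (auto simp: closed_cell_def)
        then have ve: "vertex_point v \<in> closed_cell e"
          using vertex_in_cell[OF _ finite_edge[OF e(1)]] by blast
        have "seg_length p (vertex_point v) \<le> seg_length p y + seg_length y (vertex_point v)"
          using closed_cell_support(1)[OF e(2)] closed_cell_support(1)[OF e(3)]
            closed_cell_support(1)[OF ve] by (intro seg_length_triangle)
        then show ?thesis using p_pos[OF \<open>v \<in> e\<close>] 2 len by force
      qed
    qed
  qed
qed

text \<open>
  The infimum over all paths is not known to be attained, but a point has at most two exits from
  its cell, so the best exit is as good as every path.
\<close>

lemma path_dist_through_support:
  assumes p: "p \<in> realization V E" and q: "q \<in> realization V E"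
    and far: "path_dist E p q > 1"
  shows "\<exists>v\<in>V. p v > 0 \<and>
    path_dist E p (vertex_point v) + path_dist E (vertex_point v) q \<le> path_dist E p q"
proof (rule ccontr)
  assume no: "\<not> ?thesis"
  define h where "h = (\<lambda>v. seg_length p (vertex_point v) + path_dist E (vertex_point v) q)"
  define M where "M = Min (h ` {v. p v > 0})"
  have fin: "finite {v. p v > 0}"
    by (rule finite_subset[OF _ finite_support[OF p]]) auto
  have "path_dist E p q < h v" if v: "p v > 0" for v
    using support_vertex[OF p v] no v unfolding h_def by force
  then have "path_dist E p q < M"
    using fin support_nonempty[OF p] unfolding M_def by auto
  moreover have ne: "pl_paths E p q \<noteq> {}" using pl_paths_nonempty[OF conn p q] .
  ultimately have "Inf (pl_length ` pl_paths E p q) < M" by (simp add: path_dist_def)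
  then obtain xs where xs: "xs \<in> pl_paths E p q" "pl_length xs < M"
    using ne cInf_lessD[of "pl_length ` pl_paths E p q" M] by auto
  have "\<not> (\<exists>v. p v > 0 \<and> h v \<le> pl_length xs)"
  proof
    assume "\<exists>v. p v > 0 \<and> h v \<le> pl_length xs"
    then obtain v where "p v > 0" "h v \<le> pl_length xs" by blast
    moreover from this have "M \<le> h v" unfolding M_def using fin by (intro Min_le) auto
    ultimately show False using xs(2) by simp
  qed
  then obtain e where e: "e \<in> E" "p \<in> closed_cell e" "q \<in> closed_cell e"
    using pl_path_exit[OF xs(1) p] unfolding h_def by blast
  then have "path_dist E p q \<le> 1" using path_dist_cell_le[OF e] seg_length_cell_le_1[OF e] by simp
  then show False using far by simp
qed


section \<open>The bottleneck property\<close>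

lemma open_star:
  "openin (mtopology_of (metric_graph V E)) {p \<in> realization V E. \<exists>v\<in>A. p v > 0}"
proof -
  interpret M: Metric_space "realization V E" "path_dist E"
    by (rule Metric_space_realization[OF conn])
  have "\<exists>r>0. M.mball p r \<subseteq> {p \<in> realization V E. \<exists>v\<in>A. p v > 0}"
    if p: "p \<in> realization V E" and v: "v \<in> A" "p v > 0" for p v
  proof (intro exI conjI subsetI)
    show "p v / 2 > 0" using v by simp
    fix q
    assume "q \<in> M.mball p (p v / 2)"
    then have q: "q \<in> realization V E" "path_dist E p q < p v / 2" by auto
    have "finite {w. p w \<noteq> 0 \<or> q w \<noteq> 0}"
      unfolding Collect_disj_eq using finite_support p q(1) by blast
    then have "\<bar>p v - q v\<bar> \<le> (\<Sum>w | p w \<noteq> 0 \<or> q w \<noteq> 0. \<bar>p w - q w\<bar>)"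
      using v by (intro member_le_sum) auto
    then have "\<bar>p v - q v\<bar> / 2 \<le> seg_length p q" by (simp add: seg_length_def)
    also have "\<dots> \<le> path_dist E p q" using path_dist_ge_seg_length[OF conn p q(1)] .
    finally have "\<bar>p v - q v\<bar> < p v" using q(2) by simp
    then have "q v > 0" by (simp add: abs_less_iff)
    then show "q \<in> {p \<in> realization V E. \<exists>v\<in>A. p v > 0}" using q(1) v(1) by blast
  qed
  then show ?thesis
    unfolding mtopology_of_def mspace_metric_graph[OF conn] mdist_metric_graph[OF conn]
      M.openin_mtopology by blast
qed

text \<open>
  Deleting the closed cells spanned by \<open>S\<close> leaves the open stars of the other vertices. Those
  around the component of \<open>a\<close> and those around the remaining vertices form two disjoint open
  sets, since no edge joins the two kinds of vertices.
\<close>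

lemma path_meets_separator_cells:
  assumes sep: "separates V E S a b"
    and g: "pathin (mtopology_of (metric_graph V E)) g"
    and start: "g 0 a > 0" and finish: "g 1 b > 0"
  shows "\<exists>t\<in>{0..1}. \<forall>v. g t v > 0 \<longrightarrow> v \<in> S"
proof (rule ccontr)
  assume no: "\<not> ?thesis"
  let ?X = "mtopology_of (metric_graph V E)"
  define A where "A = component E (V - S) a"
  define P where "P = {p \<in> realization V E. \<exists>v\<in>A. p v > 0}"
  define Q where "Q = {p \<in> realization V E. \<exists>v\<in>V - S - A. p v > 0}"
  have top: "topspace ?X = realization V E"
    by (simp add: mspace_metric_graph[OF conn])
  have g_in: "g t \<in> realization V E" if "t \<in> {0..1}" for t
    using pathin_subtopology[of ?X "realization V E" g] g that top
    by (metis subtopology_topspace)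
  have a: "a \<in> A" using sep component_refl unfolding A_def separates_def by metis
  have b: "b \<in> V - S - A" using sep component_eq unfolding A_def separates_def by fast
  have cover: "g ` {0..1} \<subseteq> P \<union> Q"
  proof (intro image_subsetI)
    fix t :: real
    assume t: "t \<in> {0..1}"
    then obtain v where v: "g t v > 0" "v \<notin> S" using no by blast
    then have "v \<in> V" using support_vertex(1)[OF g_in[OF t]] by blast
    then show "g t \<in> P \<union> Q" unfolding P_def Q_def using v g_in[OF t] by blast
  qed
  have "P \<inter> Q = {}"
  proof (rule ccontr)
    assume "P \<inter> Q \<noteq> {}"
    then obtain p u v where p: "p \<in> realization V E" "p u > 0" "p v > 0"
      and uv: "u \<in> A" "v \<in> V - S" "v \<notin> A"
      unfolding P_def Q_def by blast
    have "u \<noteq> v" using uv by blast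
    obtain e where e: "e \<in> E" "u \<in> e" "v \<in> e"
    proof -
      consider w where "p = vertex_point w" | e where "e \<in> E" "p \<in> closed_cell e"
        using p(1) by (auto simp: realization_def closed_cell_singleton)
      then show thesis
      proof cases
        case 1
        then show ?thesis using p \<open>u \<noteq> v\<close> by (auto simp: vertex_point_apply split: if_splits)
      next
        case 2
        have "u \<in> e" using 2(2) p(2) by (auto simp: closed_cell_def)
        moreover have "v \<in> e" using 2(2) p(3) by (auto simp: closed_cell_def)
        ultimately show ?thesis using that 2(1) by blast
      qed
    qed
    then have "{u, v} \<in> E" using \<open>u \<noteq> v\<close> edge_cases[OF e(1)] by (smt (verit) insert_commute insertE singletonD)
    then have "v \<in> A" using component_step[of u E "V - S" a v] uv unfolding A_def by blast
    then show False using uv by blast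
  qed
  moreover have "openin ?X P" "openin ?X Q" unfolding P_def Q_def by (rule open_star)+
  moreover have "connectedin ?X (g ` {0..1})" using connectedin_path_image[OF g] .
  moreover have "g 0 \<in> P" "g 1 \<in> Q" unfolding P_def Q_def using a b start finish g_in by auto
  then have "P \<inter> g ` {0..1} \<noteq> {}" "Q \<inter> g ` {0..1} \<noteq> {}" by force+
  ultimately show False using cover unfolding connectedin by blast
qed

text \<open>
  Let \<open>z\<close> be a midpoint of \<open>x\<close> and \<open>y\<close>, far from both. Geodesics from \<open>x\<close> and \<open>y\<close> to \<open>z\<close> leave
  the cells of their ends through vertices \<open>a\<close>, \<open>b\<close> and enter the cell of \<open>z\<close> through a vertex
  \<open>c\<close> within distance \<open>1\<close> of \<open>z\<close>; then \<open>c\<close> lies on a hop geodesic from \<open>a\<close> to \<open>b\<close> and hence in a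
  minimal separator \<open>S\<close> of diameter at most \<open>m\<close>. A path from \<open>x\<close> to \<open>y\<close> has a point in a cell
  spanned by \<open>S\<close>. That point is within \<open>1\<close> of a vertex of \<open>S\<close>, which is within \<open>m\<close> of
  \<open>c\<close>, which is within \<open>1\<close> of \<open>z\<close>; this is where \<open>m + 2\<close> comes from.
\<close>

lemma bottleneck_from_separator_bound:
  assumes bound: "\<And>S s t. minimal_vertex_separator V E S \<Longrightarrow> s \<in> S \<Longrightarrow> t \<in> S \<Longrightarrow> hop E s t \<le> m"
  shows "bottleneck_with (metric_graph V E) (real m + 2)"
proof -
  let ?R = "realization V E" and ?d = "path_dist E" and ?p = vertex_point
  have "\<exists>t\<in>{0..1}. g t \<in> ?R \<and> ?d z (g t) \<le> real m + 2"
    if x: "x \<in> ?R" and y: "y \<in> ?R" and z: "z \<in> ?R"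
      and mid: "?d x z = ?d x y / 2" "?d z y = ?d x y / 2"
      and g: "pathin (mtopology_of (metric_graph V E)) g" and ends: "g 0 = x" "g 1 = y"
    for x y z g
  proof (cases "?d x z \<le> real m + 2")
    case True
    then show ?thesis using x ends(1) path_dist_commute[of x z] by (intro bexI[of _ 0]) auto
  next
    case far: False
    have far_y: "?d z y > real m + 2" using mid far by simp
    have tri: "?d p r \<le> ?d p q + ?d q r" if "p \<in> ?R" "q \<in> ?R" "r \<in> ?R" for p q r
      using path_dist_triangle[OF conn that] .
    have vR: "?p v \<in> ?R" if "v \<in> V" for v using vertex_point_realization[OF that] .
    obtain a where a: "a \<in> V" "x a > 0" "?d x (?p a) + ?d (?p a) z \<le> ?d x z"
      using path_dist_through_support[OF x z] far by auto
    obtain b where b: "b \<in> V" "y b > 0" "?d y (?p b) + ?d (?p b) z \<le> ?d y z"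
      using path_dist_through_support[OF y z] far_y path_dist_commute[of y z] by auto
    have xa: "?d x (?p a) \<le> 1" using support_vertex(3)[OF x a(2)] .
    have yb: "?d y (?p b) \<le> 1" using support_vertex(3)[OF y b(2)] .
    have az: "?d (?p a) z > real m + 1" using tri[OF x vR[OF a(1)] z] xa far by simp
    have bz: "?d (?p b) z > real m + 1"
      using tri[OF y vR[OF b(1)] z] yb far_y path_dist_commute[of y z] by simp
    obtain c where c: "c \<in> V" "z c > 0" "?d z (?p c) + ?d (?p c) (?p a) \<le> ?d z (?p a)"
      using path_dist_through_support[OF z vR[OF a(1)]] az path_dist_commute[of z "?p a"] by auto
    have zc: "?d z (?p c) \<le> 1" using support_vertex(3)[OF z c(2)] .
    have ac: "?d (?p a) (?p c) > 0"
      using tri[OF vR[OF a(1)] vR[OF c(1)] z] az zc path_dist_commute[of z "?p c"] by simp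
    have cb: "?d (?p c) (?p b) > 0"
      using tri[OF vR[OF b(1)] vR[OF c(1)] z] bz zc path_dist_commute[of z "?p c"]
        path_dist_commute[of "?p b" "?p c"] by simp
    have "?d (?p a) (?p c) + ?d (?p c) (?p b) \<le> ?d (?p a) (?p b)"
      using tri[OF x vR[OF a(1)] y] tri[OF vR[OF a(1)] vR[OF b(1)] y]
        tri[OF vR[OF c(1)] z vR[OF b(1)]] a(3) b(3) c(3) mid
        path_dist_commute[of z "?p a"] path_dist_commute[of "?p c" "?p a"]
        path_dist_commute[of z "?p c"] path_dist_commute[of "?p b" z]
        path_dist_commute[of y z] path_dist_commute[of y "?p b"] by linarith
    then have "hop E a c + hop E c b \<le> hop E a b"
      using path_dist_vertices a(1) b(1) c(1) by simp
    then have geo: "hop E a c + hop E c b = hop E a b"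
      using hop_triangle[OF a(1) c(1) b(1)] by simp
    have "c \<noteq> a" "c \<noteq> b" using ac cb by (auto simp: path_dist_self)
    then obtain S where S: "minimal_ab_separator V E S a b" "c \<in> S"
      using minimal_separator_through_geodesic_vertex[OF a(1) b(1) c(1) geo] by blast
    then have sep: "separates V E S a b" and min: "minimal_vertex_separator V E S"
      using a(1) b(1) unfolding minimal_vertex_separator_def minimal_ab_separator_def by auto
    have "g 0 a > 0" "g 1 b > 0" using a(2) b(2) ends by auto
    from path_meets_separator_cells[OF sep g this]
    obtain t where t: "t \<in> {0..1}" "\<And>v. g t v > 0 \<Longrightarrow> v \<in> S" by blast
    have gt: "g t \<in> ?R"
      using pathin_subtopology[of "mtopology_of (metric_graph V E)" ?R g] g t(1)
      by (metis mspace_metric_graph[OF conn] subtopology_topspace topspace_mtopology_of)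
    obtain s where s: "g t s > 0" using support_nonempty[OF gt] by blast
    have sV: "s \<in> V" and gs: "?d (g t) (?p s) \<le> 1" using support_vertex[OF gt s] by auto
    have "?d (?p c) (?p s) \<le> real m"
      using bound[OF min S(2) t(2)[OF s]] path_dist_vertices[OF c(1) sV] by simp
    then have "?d z (g t) \<le> real m + 2"
      using tri[OF z vR[OF c(1)] gt] tri[OF vR[OF c(1)] vR[OF sV] gt] zc gs
        path_dist_commute[of "g t" "?p s"] by linarith
    then show ?thesis using t(1) gt by blast
  qed
  note meets = this
  show ?thesis
    unfolding bottleneck_with_def mspace_metric_graph[OF conn] mdist_metric_graph[OF conn]
  proof (intro conjI ballI allI impI)
    fix x y z g
    assume "x \<in> ?R" "y \<in> ?R" "z \<in> ?R"
      and "x \<noteq> y \<and> ?d x z = ?d x y / 2 \<and> ?d z y = ?d x y / 2"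
      and "pathin (mtopology_of (metric_graph V E)) g \<and> g 0 = x \<and> g 1 = y"
    then obtain t where "t \<in> {0..1}" "g t \<in> ?R" "?d z (g t) \<le> real m + 2"
      using meets[of x y z g] by blast
    then show "g ` {0..1} \<inter> {w \<in> ?R. ?d z w \<le> real m + 2} \<noteq> {}" by blast
  qed simp
qed


section \<open>Clusters of a layered graph\<close>

text \<open>
  The layers are the spheres around a root \<open>r\<close>; two vertices of a layer belong to the same
  cluster if they can be joined without coming closer to the root.
\<close>

definition cluster :: "'v \<Rightarrow> 'v \<Rightarrow> 'v set" where
  "cluster r v = {u \<in> V. hop E r u = hop E r v \<and> u \<in> component E {w \<in> V. hop E r v \<le> hop E r w} v}"

definition cluster_rep :: "'v \<Rightarrow> 'v \<Rightarrow> 'v" where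
  "cluster_rep r v = (SOME u. u \<in> cluster r v)"

definition cluster_parent :: "'v \<Rightarrow> 'v \<Rightarrow> 'v" where
  "cluster_parent r t = cluster_rep r (SOME p. {p, t} \<in> E \<and> Suc (hop E r p) = hop E r t)"

lemma cluster_refl: "v \<in> V \<Longrightarrow> v \<in> cluster r v"
  unfolding cluster_def by (auto intro: component_refl)

lemma cluster_eq: "u \<in> cluster r v \<Longrightarrow> cluster r u = cluster r v"
  unfolding cluster_def using component_eq[of u E "{w \<in> V. hop E r v \<le> hop E r w}" v] by auto

lemma cluster_rep_in: "v \<in> V \<Longrightarrow> cluster_rep r v \<in> cluster r v"
  unfolding cluster_rep_def using cluster_refl by (rule someI)

lemma cluster_rep_V: "v \<in> V \<Longrightarrow> cluster_rep r v \<in> V"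
  and hop_cluster_rep: "v \<in> V \<Longrightarrow> hop E r (cluster_rep r v) = hop E r v"
  using cluster_rep_in unfolding cluster_def by auto

lemma cluster_rep_eq: "u \<in> cluster r v \<Longrightarrow> cluster_rep r u = cluster_rep r v"
  unfolding cluster_rep_def by (simp add: cluster_eq)

lemma cluster_rep_idem: "v \<in> V \<Longrightarrow> cluster_rep r (cluster_rep r v) = cluster_rep r v"
  using cluster_rep_eq cluster_rep_in by blast

text \<open>
  A geodesic between two vertices \<open>u\<close>, \<open>v\<close> of a cluster has a detour that stays in or above the
  layer, so its middle \<open>c\<close> is not far below the layer. It also has the detour that
  runs down to the root and up again along geodesics; at the level of \<open>c\<close> this detour is close
  to \<open>u\<close> or to \<open>v\<close>.
\<close>

lemma cluster_diameter:
  assumes bound: "\<And>S s t. minimal_vertex_separator V E S \<Longrightarrow> s \<in> S \<Longrightarrow> t \<in> S \<Longrightarrow> hop E s t \<le> m"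
    and V: "r \<in> V" "v \<in> V" and u: "u \<in> cluster r v"
  shows "hop E u v \<le> 6 * m + 1"
proof (cases "hop E u v < 2")
  case True
  then show ?thesis by simp
next
  case False
  have uV: "u \<in> V" and lev: "hop E r u = hop E r v"
    and comp: "v \<in> component E {w \<in> V. hop E r v \<le> hop E r w} u"
    using u component_sym unfolding cluster_def by auto
  obtain c where c: "c \<in> V" "hop E u c = hop E u v div 2" "hop E c v = hop E u v - hop E u v div 2"
    using geodesic_vertex_at[OF uV V(2), of "hop E u v div 2"] by auto
  have geo: "hop E u c + hop E c v = hop E u v" using c by simp
  have "c \<noteq> u" "c \<noteq> v" using c False by auto
  have near: "\<exists>w\<in>W. hop E c w \<le> m" if "W \<subseteq> V" "v \<in> component E W u" for W
    by (rule connecting_set_near_geodesic[OF _ uV V(2) c(1) geo \<open>c \<noteq> u\<close> \<open>c \<noteq> v\<close> that])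
      (rule bound)
  obtain w where w: "w \<in> V" "hop E r v \<le> hop E r w" "hop E c w \<le> m"
    using near[OF _ comp] by auto
  define I where "I = (\<lambda>x. {w \<in> V. hop E r w + hop E w x = hop E r x})"
  have "u \<in> component E (I u) r" "v \<in> component E (I v) r"
    unfolding I_def using interval_connected[of r] V uV by auto
  then have "v \<in> component E (I u \<union> I v) u"
    using component_mono[of "I u" "I u \<union> I v" E r] component_mono[of "I v" "I u \<union> I v" E r]
      component_trans component_sym by (metis Un_upper1 Un_upper2 subsetD)
  moreover have "I u \<union> I v \<subseteq> V" unfolding I_def by blast
  ultimately obtain w' where w': "w' \<in> I u \<union> I v" "hop E c w' \<le> m" using near by blast
  then have w'V: "w' \<in> V" unfolding I_def by blast
  have "hop E r w \<le> hop E r w' + 2 * m"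
    using hop_triangle[OF V(1) w'V w(1)] hop_triangle[OF w'V c(1) w(1)] w(3) w'(2)
      hop_commute[of w' c] by simp
  \<comment> \<open>On a geodesic to the root, the distance to its upper end is the difference of the levels.\<close>
  then have "hop E w' u \<le> 2 * m \<or> hop E w' v \<le> 2 * m"
    using w'(1) w(2) lev unfolding I_def by auto
  \<comment> \<open>As \<open>c\<close> halves the geodesic up to rounding, twice \<open>3 * m\<close> and one more bound its length.\<close>
  then have "hop E c u \<le> 3 * m \<or> hop E c v \<le> 3 * m"
    using hop_triangle[OF c(1) w'V uV] hop_triangle[OF c(1) w'V V(2)] w'(2) by auto
  then show ?thesis using c hop_commute[of c u] by auto
qed

lemma cluster_parent_pred:
  assumes "r \<in> V" "t \<in> V" "hop E r t \<noteq> 0"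
  obtains p where "{p, t} \<in> E" "Suc (hop E r p) = hop E r t" "cluster_parent r t = cluster_rep r p"
proof -
  obtain n where n: "hop E r t = Suc n" using assms(3) not0_implies_Suc by blast
  have "\<exists>p. {p, t} \<in> E \<and> Suc (hop E r p) = hop E r t"
    using hop_pred[OF assms(1,2) n] n by metis
  from someI_ex[OF this] show thesis using that unfolding cluster_parent_def by blast
qed

text \<open>
  All neighbours of a cluster in the layer below lie in one cluster, because they are joined
  through the cluster and what lies above it.
\<close>

lemma cluster_parent_edge:
  assumes r: "r \<in> V" and uv: "{u, v} \<in> E" and lev: "hop E r v = Suc (hop E r u)"
  shows "cluster_parent r (cluster_rep r v) = cluster_rep r u"
proof -
  define t where "t = cluster_rep r v"
  have V: "u \<in> V" "v \<in> V" using edge_vertices[OF uv] by auto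
  have t: "t \<in> V" "hop E r t = hop E r v" "t \<in> component E {w \<in> V. hop E r v \<le> hop E r w} v"
    using cluster_rep_in[OF V(2), of r] unfolding t_def cluster_def by auto
  obtain p where p: "{p, t} \<in> E" "Suc (hop E r p) = hop E r t" "cluster_parent r t = cluster_rep r p"
    using cluster_parent_pred[OF r t(1)] t(2) lev by auto
  let ?W = "{w \<in> V. hop E r u \<le> hop E r w}"
  have "v \<in> component E ?W u"
    using component_step[OF component_refl uv, of ?W] V lev by simp
  moreover have "t \<in> component E ?W v"
    using component_mono[of "{w \<in> V. hop E r v \<le> hop E r w}" ?W E v] t(3) lev by fastforce
  ultimately have "t \<in> component E ?W u" by (rule component_trans)
  moreover have "{t, p} \<in> E" using p(1) by (simp add: insert_commute)
  moreover have pV: "p \<in> V" "hop E r p = hop E r u" using edge_vertices[OF p(1)] p(2) t(2) lev by auto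
  ultimately have "p \<in> component E ?W u" using component_step[of t E ?W u p] by simp
  then have "p \<in> cluster r u" using pV unfolding cluster_def by simp
  then show ?thesis using p(3) cluster_rep_eq unfolding t_def by simp
qed


section \<open>The tree of clusters\<close>

definition tree_verts :: "'v \<Rightarrow> 'v set" where
  "tree_verts r = cluster_rep r ` V"

definition tree_edges :: "'v \<Rightarrow> 'v set set" where
  "tree_edges r = {{t, cluster_parent r t} | t. t \<in> tree_verts r - {r}}"

lemma tree_verts_V: "t \<in> tree_verts r \<Longrightarrow> t \<in> V \<and> cluster_rep r t = t"
  unfolding tree_verts_def using cluster_rep_V cluster_rep_idem by auto

lemma cluster_tree:
  assumes r: "r \<in> V"
  shows "tree_graph (tree_verts r) (tree_edges r)"
  unfolding tree_edges_def
proof (rule tree_of_parent[where lev = "hop E r"])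
  have "cluster_rep r r = r"
    using cluster_rep_V[OF r, of r] hop_cluster_rep[OF r, of r] hop_eq_0[OF r] by auto
  then show "r \<in> tree_verts r" using r unfolding tree_verts_def by (metis imageI)
next
  fix t
  assume t: "t \<in> tree_verts r" "t \<noteq> r"
  then have "hop E r t \<noteq> 0" using hop_eq_0[OF r] tree_verts_V by metis
  then obtain p where p: "{p, t} \<in> E" "Suc (hop E r p) = hop E r t"
      "cluster_parent r t = cluster_rep r p"
    using cluster_parent_pred[OF r] t tree_verts_V by metis
  then have "p \<in> V" using edge_vertices by blast
  then show "cluster_parent r t \<in> tree_verts r \<and> hop E r (cluster_parent r t) < hop E r t"
    using p hop_cluster_rep[of p r] unfolding tree_verts_def by auto
qed

lemma cluster_tree_conn_graph: "r \<in> V \<Longrightarrow> conn_graph (tree_verts r) (tree_edges r)"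
  using cluster_tree unfolding tree_graph_def by unfold_locales blast

lemma tree_hop_edge_le:
  assumes r: "r \<in> V" and uv: "{u, v} \<in> E"
  shows "hop (tree_edges r) (cluster_rep r u) (cluster_rep r v) \<le> 1"
proof -
  interpret T: conn_graph "tree_verts r" "tree_edges r" using cluster_tree_conn_graph[OF r] .
  have up: "hop (tree_edges r) (cluster_rep r u) (cluster_rep r v) \<le> 1"
    if uv: "{u, v} \<in> E" and lev: "hop E r v = Suc (hop E r u)" for u v
  proof -
    have v: "v \<in> V" using edge_vertices[OF uv] by blast
    then have "cluster_rep r v \<noteq> r"
      using hop_cluster_rep[OF v, of r] lev by (metis hop_self nat.distinct(1))
    then have "{cluster_rep r v, cluster_parent r (cluster_rep r v)} \<in> tree_edges r"
      using v unfolding tree_edges_def tree_verts_def by blast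
    then have "{cluster_rep r u, cluster_rep r v} \<in> tree_edges r"
      unfolding cluster_parent_edge[OF r uv lev] by (simp add: insert_commute)
    then show ?thesis by (rule T.hop_edge)
  qed
  have V: "u \<in> V" "v \<in> V" using edge_vertices[OF uv] by auto
  have vu: "{v, u} \<in> E" using uv by (simp add: insert_commute)
  consider "hop E r v = Suc (hop E r u)" | "hop E r u = Suc (hop E r v)" | "hop E r u = hop E r v"
    using hop_edge_le[OF uv r] hop_edge_le[OF vu r] by linarith
  then show ?thesis
  proof cases
    case 3
    have "v \<in> component E {w \<in> V. hop E r u \<le> hop E r w} u"
      using component_step[OF component_refl uv, of "{w \<in> V. hop E r u \<le> hop E r w}"] V 3 by simp
    then have "v \<in> cluster r u" using V 3 unfolding cluster_def by simp
    then show ?thesis using cluster_rep_eq by simp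
  qed (use up[OF uv] up[OF vu] T.hop_commute in auto)
qed

lemma tree_hop_le_hop:
  assumes r: "r \<in> V" and V: "u \<in> V" "v \<in> V"
  shows "hop (tree_edges r) (cluster_rep r u) (cluster_rep r v) \<le> hop E u v"
  using V(2)
proof (induction "hop E u v" arbitrary: v)
  case 0
  then show ?case using hop_eq_0[OF V(1)] conn_graph.hop_self[OF cluster_tree_conn_graph[OF r]] by simp
next
  case (Suc n)
  interpret T: conn_graph "tree_verts r" "tree_edges r" using cluster_tree_conn_graph[OF r] .
  obtain w where w: "w \<in> V" "{w, v} \<in> E" "hop E u w = n"
    using hop_pred[OF V(1) Suc.prems] Suc.hyps(2) by metis
  have "cluster_rep r x \<in> tree_verts r" if "x \<in> V" for x using that unfolding tree_verts_def by simp
  then show ?case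
    using T.hop_triangle[of "cluster_rep r u" "cluster_rep r w" "cluster_rep r v"]
      tree_hop_edge_le[OF r w(2)] Suc w V(1) by fastforce
qed

lemma hop_le_tree_hop:
  assumes r: "r \<in> V" and diam: "\<And>u v. v \<in> V \<Longrightarrow> u \<in> cluster r v \<Longrightarrow> hop E u v \<le> K"
    and s: "s \<in> tree_verts r" and t: "t \<in> tree_verts r"
  shows "hop E s t \<le> (K + 1) * hop (tree_edges r) s t"
  using t
proof (induction "hop (tree_edges r) s t" arbitrary: t)
  interpret T: conn_graph "tree_verts r" "tree_edges r" using cluster_tree_conn_graph[OF r] .
  case 0
  then show ?case using T.hop_eq_0[OF s] by simp
next
  interpret T: conn_graph "tree_verts r" "tree_edges r" using cluster_tree_conn_graph[OF r] .
  case (Suc n)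
  have parent: "hop E x (cluster_parent r x) \<le> K + 1" if x: "x \<in> tree_verts r" "x \<noteq> r" for x
  proof -
    have xV: "x \<in> V" using x tree_verts_V by blast
    then have "hop E r x \<noteq> 0" using hop_eq_0[OF r] x by metis
    then obtain p where p: "{p, x} \<in> E" "cluster_parent r x = cluster_rep r p"
      using cluster_parent_pred[OF r xV] by metis
    have pV: "p \<in> V" using edge_vertices[OF p(1)] by blast
    have "hop E p (cluster_rep r p) \<le> K"
      using diam[OF pV cluster_rep_in[OF pV]] hop_commute by metis
    then show ?thesis
      using hop_triangle[OF xV pV cluster_rep_V[OF pV, of r]] hop_edge[OF p(1)] hop_commute[of x p] p(2)
      by simp
  qed
  obtain w where w: "w \<in> tree_verts r" "{w, t} \<in> tree_edges r" "hop (tree_edges r) s w = n"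
    using T.hop_pred[OF s Suc.prems] Suc.hyps(2) by metis
  obtain x where x: "x \<in> tree_verts r" "x \<noteq> r" "{w, t} = {x, cluster_parent r x}"
    using w(2) unfolding tree_edges_def by blast
  have "hop E w t \<le> K + 1"
    using parent[OF x(1,2)] x(3) hop_commute by (auto simp: doubleton_eq_iff)
  moreover have "hop E s w \<le> (K + 1) * n" using Suc.hyps(1)[of w] w by simp
  moreover have "hop E s t \<le> hop E s w + hop E w t"
    using hop_triangle tree_verts_V s w(1) Suc.prems by blast
  ultimately have "hop E s t \<le> (K + 1) * n + (K + 1)" by linarith
  then show ?case unfolding Suc.hyps(2)[symmetric] by simp
qed

text \<open>
  Sending a point to a vertex of its cell and then to the representative of its cluster is the
  quasi-isometry. It does not increase hop distances; in the other direction every tree edge is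
  realized by one edge of the graph and a move inside a cluster.
\<close>

lemma quasi_isometric_cluster_tree:
  assumes r: "r \<in> V" and diam: "\<And>u v. v \<in> V \<Longrightarrow> u \<in> cluster r v \<Longrightarrow> hop E u v \<le> K"
  shows "quasi_isometric (metric_graph V E) (metric_graph (tree_verts r) (tree_edges r))"
proof -
  interpret T: conn_graph "tree_verts r" "tree_edges r" using cluster_tree_conn_graph[OF r] .
  define vtx where "vtx = (\<lambda>p::'v \<Rightarrow> real. SOME v. p v > 0)"
  define f where "f = (\<lambda>p. vertex_point (cluster_rep r (vtx p)))"
  have vtx: "p (vtx p) > 0" "vtx p \<in> V" "path_dist E p (vertex_point (vtx p)) \<le> 1"
    if p: "p \<in> realization V E" for p
  proof -
    show "p (vtx p) > 0" unfolding vtx_def by (rule someI_ex[OF support_nonempty[OF p]])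
    then show "vtx p \<in> V" "path_dist E p (vertex_point (vtx p)) \<le> 1" using support_vertex[OF p] by auto
  qed
  have vtx_vertex: "vtx (vertex_point v) = v" for v
    unfolding vtx_def by (auto simp: vertex_point_apply)
  have rep: "cluster_rep r v \<in> tree_verts r" if "v \<in> V" for v using that unfolding tree_verts_def by simp
  have f_in: "f p \<in> realization (tree_verts r) (tree_edges r)" if "p \<in> realization V E" for p
    unfolding f_def using T.vertex_point_realization rep vtx(2)[OF that] by blast

  \<comment> \<open>Moving both points to vertices costs \<open>2\<close>, moving both vertices to representatives \<open>2 * K\<close>.\<close>
  have main: "path_dist E p q \<le> (real K + 1) * path_dist (tree_edges r) (f p) (f q) + (2 * real K + 2) \<and>
      path_dist (tree_edges r) (f p) (f q) \<le> path_dist E p q + 2"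
    if p: "p \<in> realization V E" and q: "q \<in> realization V E" for p q
  proof -
    define u v where "u = vtx p" and "v = vtx q"
    define n where "n = hop (tree_edges r) (cluster_rep r u) (cluster_rep r v)"
    have V: "u \<in> V" "v \<in> V" using vtx(2) p q unfolding u_def v_def by auto
    have near: "path_dist E p (vertex_point u) \<le> 1" "path_dist E q (vertex_point v) \<le> 1"
      using vtx(3) p q unfolding u_def v_def by auto
    have uv: "path_dist E (vertex_point u) (vertex_point v) = real (hop E u v)"
      using path_dist_vertices[OF V] .
    have fpq: "path_dist (tree_edges r) (f p) (f q) = real n"
      using T.path_dist_vertices[OF rep[OF V(1)] rep[OF V(2)]] unfolding f_def n_def u_def v_def .
    note R = p q vertex_point_realization[OF V(1)] vertex_point_realization[OF V(2)]
    have "path_dist E p q \<le> real (hop E u v) + 2" "real (hop E u v) \<le> path_dist E p q + 2"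
      using path_dist_triangle[OF conn R(1,3,2)] path_dist_triangle[OF conn R(3,4,2)]
        path_dist_triangle[OF conn R(3,1,4)] path_dist_triangle[OF conn R(1,2,4)] near uv
        path_dist_commute[of "vertex_point u" p] path_dist_commute[of "vertex_point v" q] by linarith+
    moreover have "n \<le> hop E u v" unfolding n_def using tree_hop_le_hop[OF r V] .
    moreover have "hop E u v \<le> (K + 1) * n + 2 * K"
    proof -
      have cu: "cluster_rep r u \<in> V" "hop E (cluster_rep r u) u \<le> K"
        and cv: "cluster_rep r v \<in> V" "hop E (cluster_rep r v) v \<le> K"
        using cluster_rep_V[OF V(1)] cluster_rep_V[OF V(2)] diam[OF V(1) cluster_rep_in[OF V(1)]]
          diam[OF V(2) cluster_rep_in[OF V(2)]] by simp_all
      have "hop E (cluster_rep r u) (cluster_rep r v) \<le> (K + 1) * n"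
        unfolding n_def using hop_le_tree_hop[OF r diam rep[OF V(1)] rep[OF V(2)]] by blast
      then show ?thesis
        using hop_triangle[OF V(1) cu(1) V(2)] hop_triangle[OF cu(1) cv(1) V(2)] cu cv
          hop_commute[of u "cluster_rep r u"] by linarith
    qed
    then have "real (hop E u v) \<le> (real K + 1) * real n + 2 * real K"
      by (metis (mono_tags, opaque_lifting) of_nat_1 of_nat_add of_nat_le_iff of_nat_mult of_nat_numeral)
    ultimately show ?thesis unfolding fpq by simp
  qed

  have "quasi_isometry (metric_graph V E) (metric_graph (tree_verts r) (tree_edges r)) f"
    unfolding quasi_isometry_def mspace_metric_graph[OF conn] mdist_metric_graph[OF conn]
      mspace_metric_graph[OF T.conn] mdist_metric_graph[OF T.conn]
  proof (intro conjI exI ballI)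
    show "f \<in> realization V E \<rightarrow> realization (tree_verts r) (tree_edges r)" using f_in by blast
    show "(1::real) \<le> real K + 1" "0 < 2 * real K + 2" "(0::real) < 1" by auto
    fix p q
    assume pq: "p \<in> realization V E" "q \<in> realization V E"
    let ?d = "path_dist E p q" and ?t = "path_dist (tree_edges r) (f p) (f q)"
    have "?d \<le> (real K + 1) * (?t + (2 * real K + 2))"
    proof -
      have "2 * real K + 2 \<le> (real K + 1) * (2 * real K + 2)" by (simp add: algebra_simps)
      then show ?thesis using main[OF pq] unfolding distrib_left[of _ ?t] by linarith
    qed
    then have "?d / (real K + 1) \<le> ?t + (2 * real K + 2)"
      by (simp add: divide_le_eq mult.commute)
    then show "1 / (real K + 1) * ?d - (2 * real K + 2) \<le> ?t" by simp
    have "?d \<le> (real K + 1) * ?d" using path_dist_nonneg[of E p q] by (simp add: algebra_simps)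
    then show "?t \<le> (real K + 1) * ?d + (2 * real K + 2)" using main[OF pq] by simp
  next
    fix y
    assume y: "y \<in> realization (tree_verts r) (tree_edges r)"
    obtain t where t: "y t > 0" using T.support_nonempty[OF y] by blast
    note t = t T.support_vertex[OF y t]
    have "f (vertex_point t) = vertex_point t"
      unfolding f_def vtx_vertex using tree_verts_V t(2) by simp
    then have "path_dist (tree_edges r) y (f (vertex_point t)) \<le> 1" using t by simp
    moreover have "vertex_point t \<in> realization V E"
      using vertex_point_realization tree_verts_V t(2) by blast
    moreover have "bdd_below ((\<lambda>x. path_dist (tree_edges r) y (f x)) ` realization V E)"
      by (rule bdd_belowI[of _ 0]) (auto simp: path_dist_nonneg)
    ultimately show "(INF x\<in>realization V E. path_dist (tree_edges r) y (f x)) \<le> 1"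
      by (intro cINF_lower2)
  qed
  then show ?thesis unfolding quasi_isometric_def by blast
qed

end


section \<open>Graphs with small minimal separators\<close>

theorem theorem3p12:
  fixes V :: "'v set" and E :: "'v set set" and m :: nat
  assumes "connected_graph V E"
    and "uniform_graph V E"
    and "\<And>S. minimal_vertex_separator V E S \<Longrightarrow>
           mdiameter (metric_graph V E) (vertex_point ` S) \<le> of_nat m"
  shows "bottleneck_property (metric_graph V E) \<and>
         (\<exists>(V\<^sub>T :: 'v set) E\<^sub>T. tree_graph V\<^sub>T E\<^sub>T \<and>
            quasi_isometric (metric_graph V E) (metric_graph V\<^sub>T E\<^sub>T)) \<and>
         bottleneck_with (metric_graph V E) (real m + 2)"
proof -
  interpret conn_graph V E by unfold_locales (rule assms(1))
  have bound: "hop E s t \<le> m" if S: "minimal_vertex_separator V E S" and st: "s \<in> S" "t \<in> S" for S s t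
  proof -
    have "s \<in> V" "t \<in> V"
      using S st unfolding minimal_vertex_separator_def minimal_ab_separator_def separates_def by auto
    then have "ennreal (real (hop E s t)) = ennreal (mdist (metric_graph V E) (vertex_point s) (vertex_point t))"
      by (simp add: mdist_metric_graph[OF conn] path_dist_vertices)
    also have "\<dots> \<le> mdiameter (metric_graph V E) (vertex_point ` S)"
      unfolding mdiameter_def using st by (intro SUP_upper2[of "vertex_point s"] SUP_upper2[of "vertex_point t"]) auto
    also have "\<dots> \<le> ennreal (real m)" using assms(3)[OF S] by (simp add: ennreal_of_nat_eq_real_of_nat)
    finally show ?thesis by simp
  qed
  have "bottleneck_with (metric_graph V E) (real m + 2)"
    by (rule bottleneck_from_separator_bound) (rule bound)
  moreover obtain r where r: "r \<in> V" using assms(1) unfolding connected_graph_def by blast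
  have "hop E u v \<le> 6 * m + 1" if "v \<in> V" "u \<in> cluster r v" for u v
    by (rule cluster_diameter[OF _ r that]) (rule bound)
  from quasi_isometric_cluster_tree[OF r this]
  have "quasi_isometric (metric_graph V E) (metric_graph (tree_verts r) (tree_edges r))" .
  ultimately show ?thesis
    using cluster_tree[OF r] unfolding bottleneck_property_def by blast
qed

end
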